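(* There exists a planar graph $G$ with $\chi_2(G)=20$.
   Context: A signified graph $(G,\Sigma)$ is a simple graph $G$ with a set $\Sigma\subseteq E(G)$ of negative edges, other edges positive. A signified homomorphism of $(G,\Sigma)$ to $(H,\Lambda)$ is a map $V(G)\to V(H)$ sending every edge to an edge of the same sign. $\chi_2(G,\Sigma)$ is the minimum number of vertices of a signified graph to which $(G,\Sigma)$ admits a signified homomorphism, and $\chi_2(G)=\max_{\Sigma\subseteq E(G)}\chi_2(G,\Sigma)$. *)

theory Defs
  imports "HOL-Analysis.Analysis"
begin

definition sgraph :: "'a set \<Rightarrow> 'a set set \<Rightarrow> bool" where
  "sgraph V E \<longleftrightarrow> finite V \<and> (\<forall>e\<in>E. \<exists>u v. e = {u, v} \<and> u \<noteq> v \<and> u \<in> V \<and> v \<in> V)"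

definition planar :: "'a set \<Rightarrow> 'a set set \<Rightarrow> bool" where
  "planar V E \<longleftrightarrow> (\<exists>(p :: 'a \<Rightarrow> real^2) (\<gamma> :: 'a set \<Rightarrow> real \<Rightarrow> real^2).
     inj_on p V \<and>
     (\<forall>e\<in>E. arc (\<gamma> e) \<and> (\<exists>u v. e = {u, v} \<and> pathstart (\<gamma> e) = p u \<and> pathfinish (\<gamma> e) = p v)) \<and>
     (\<forall>e\<in>E. \<forall>w\<in>V. p w \<in> path_image (\<gamma> e) \<longrightarrow> w \<in> e) \<and>
     (\<forall>e\<in>E. \<forall>e'\<in>E. e \<noteq> e' \<longrightarrow> path_image (\<gamma> e) \<inter> path_image (\<gamma> e') \<subseteq> p ` (e \<inter> e')))"

text \<open>Signified homomorphism of (V,E,S) to (W,F,L): S, L are the negative edge sets.\<close>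
definition sig_hom :: "'a set \<Rightarrow> 'a set set \<Rightarrow> 'a set set \<Rightarrow> 'b set \<Rightarrow> 'b set set \<Rightarrow> 'b set set \<Rightarrow> ('a \<Rightarrow> 'b) \<Rightarrow> bool" where
  "sig_hom V E S W F L f \<longleftrightarrow> f ` V \<subseteq> W \<and> (\<forall>e\<in>E. f ` e \<in> F \<and> (f ` e \<in> L \<longleftrightarrow> e \<in> S))"

text \<open>chi_2(G,Sigma): least number of vertices of a signified (simple) graph admitting a
signified homomorphism from (G,Sigma). Targets are taken with vertices in nat (any finite
graph is isomorphic to one with vertices in nat).\<close>
definition chi2_sig :: "'a set \<Rightarrow> 'a set set \<Rightarrow> 'a set set \<Rightarrow> nat" where
  "chi2_sig V E S = (LEAST n. \<exists>(W :: nat set) F L f.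
      sgraph W F \<and> L \<subseteq> F \<and> card W = n \<and> sig_hom V E S W F L f)"

definition chi2 :: "'a set \<Rightarrow> 'a set set \<Rightarrow> nat" where
  "chi2 V E = Max {chi2_sig V E S | S. S \<subseteq> E}"

end

(*
The graph is a planar 3-tree, built from a triangle by repeatedly putting a new vertex into a
bounded face and joining it to the three corners; the centroid gives a straight-line drawing.

Upper bound.  In the Tromp graph over the Paley graph of order 9, which has 20 vertices, every
triangle has a common neighbour with any three prescribed signs.  Hence every signed planar
3-tree maps to it, one vertex after the other.

Lower bound.  A path with alternating signs needs 4 colours.  A vertex joined positively to one
such path and negatively to another needs 1 + 4 + 4 = 9 colours, and a vertex joined positively
to one such gadget and negatively to another needs 1 + 9 + 9 = 19.  If every vertex of a 19-chromatic
part carries these gadgets and only 19 colours are used, then every colour has exactly 9 positive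
neighbours, and the positive edges form a 9-regular graph on 19 vertices, which contradicts parity.
*)

theory Submission
  imports Defs
begin

text \<open>All lower bounds rest on one observation: two vertices joined to a common vertex with
  opposite signs receive different colours, because a pair of colours carries only one sign.
  Counting alone stops at 19; the last colour comes from parity, and parity needs information about
  every colour. Saturating every vertex is impossible in a finite graph, since each gadget brings
  new, unsaturated vertices. It suffices to saturate the finite part that already forces 19 colours:
  if only 19 are available, its image is the whole target, so every colour is the colour of a
  saturated vertex. Gadgets do not compete for room: stacking into a face leaves every old edge on
  some face, so any number of gadgets can be hung on the same vertex or edge. They can be nested
  without losing planarity because a path stacked over an edge is joined in full to both ends of
  that edge, so one path counts for two vertices at once.\<close>

section \<open>Barycentric coordinates and the subdivision of a triangle at its centroid\<close>

text \<open>The two coefficient sums are only required to agree, not to be 1: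
  \<open>noncollinear_centroid\<close> applies the uniqueness to a linear dependency, whose
  coefficients sum to 0.\<close>

lemma barycentric_unique:
  fixes A B C :: "'v::real_vector"
  assumes aff: "\<not> affine_dependent {A, B, C}" and ne: "A \<noteq> B" "A \<noteq> C" "B \<noteq> C"
    and sum: "a + b + c = a' + b' + (c'::real)"
    and eq: "a *\<^sub>R A + b *\<^sub>R B + c *\<^sub>R C = a' *\<^sub>R A + b' *\<^sub>R B + c' *\<^sub>R C"
  shows "a = a'" "b = b'" "c = c'"
proof -
  define u where "u v = (if v = A then a - a' else if v = B then b - b' else c - c')" for v
  have s: "(\<Sum>v\<in>{A, B, C}. g v) = g A + g B + g C" for g :: "'v \<Rightarrow> 'b::comm_monoid_add"
    using ne by (simp add: add.assoc)
  have "sum u {A, B, C} = 0"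
    using ne sum unfolding s by (simp add: u_def)
  moreover have "(\<Sum>v\<in>{A, B, C}. u v *\<^sub>R v) = 0"
    using ne eq unfolding s by (simp add: u_def algebra_simps)
  ultimately have "\<forall>v\<in>{A, B, C}. u v = 0"
    using aff affine_dependent_explicit_finite[of "{A, B, C}"] by blast
  then show "a = a'" "b = b'" "c = c'"
    using ne by (auto simp: u_def split: if_splits)
qed

abbreviation (input) open_triangle :: "(real^2) set \<Rightarrow> (real^2) set" where
  "open_triangle P \<equiv> interior (convex hull P)"

context
  fixes A B C X :: "real^2"
  assumes ncol: "\<not> collinear {A, B, C}"
    and X: "3 *\<^sub>R X = A + B + C"
begin

lemma centroid_eq: "X = (1/3) *\<^sub>R A + (1/3) *\<^sub>R B + (1/3) *\<^sub>R C"
proof -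
  have "X = (1/3) *\<^sub>R (3 *\<^sub>R X)" by simp
  then show ?thesis unfolding X by (simp add: scaleR_add_right)
qed

lemma coordinates_unique:
  assumes "a + b + c = a' + b' + c'"
    and "a *\<^sub>R A + b *\<^sub>R B + c *\<^sub>R C = a' *\<^sub>R A + b' *\<^sub>R B + c' *\<^sub>R C"
  shows "a = a' \<and> b = b' \<and> c = c'"
  using barycentric_unique[OF _ _ _ _ assms] ncol by (auto simp: collinear_3_eq_affine_dependent)

lemma centroid_combination: "a *\<^sub>R X + b *\<^sub>R B + c *\<^sub>R C = (a/3) *\<^sub>R A + (b + a/3) *\<^sub>R B + (c + a/3) *\<^sub>R C"
  unfolding centroid_eq by (simp add: algebra_simps)

lemma noncollinear_centroid: "\<not> collinear {X, B, C}"
proof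
  assume "collinear {X, B, C}"
  then consider "X = B" | "X = C" | "B = C" | "affine_dependent {X, B, C}" "X \<noteq> B" "X \<noteq> C" "B \<noteq> C"
    unfolding collinear_3_eq_affine_dependent by blast
  then show False
  proof cases
    case 1
    then show False using coordinates_unique[of "1/3" "1/3" "1/3" 0 1 0] centroid_eq by simp
  next
    case 2
    then show False using coordinates_unique[of "1/3" "1/3" "1/3" 0 0 1] centroid_eq by simp
  next
    case 3
    then show False using ncol by simp
  next
    case 4
    then obtain u where u: "sum u {X, B, C} = 0" "\<exists>v\<in>{X, B, C}. u v \<noteq> 0"
      "(\<Sum>v\<in>{X, B, C}. u v *\<^sub>R v) = 0"
      using affine_dependent_explicit_finite[of "{X, B, C}"] by blast
    have s: "u X + u B + u C = 0" using 4 u(1) by (simp add: add.assoc)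
    have "u X *\<^sub>R X + u B *\<^sub>R B + u C *\<^sub>R C = 0" using 4 u(3) by (simp add: add.assoc)
    then have "u X / 3 = 0 \<and> u B + u X / 3 = 0 \<and> u C + u X / 3 = 0"
      unfolding centroid_combination using s coordinates_unique[of "u X / 3" "u B + u X / 3" "u C + u X / 3" 0 0 0] by simp
    then show False using u(2) by auto
  qed
qed

lemma open_triangle_eq:
  "open_triangle {A, B, C} = {a *\<^sub>R A + b *\<^sub>R B + c *\<^sub>R C |a b c. 0 < a \<and> 0 < b \<and> 0 < c \<and> a + b + c = 1}"
  using interior_convex_hull_3_minimal[OF ncol] by fastforce

text \<open>Expanding \<open>X\<close> gives a third of its weight to each corner, so the
  subtriangle that omits \<open>A\<close> lies where the \<open>A\<close>-coordinate is strictly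
  smallest. The disjointness lemmas below reduce to comparing such inequalities.\<close>

lemma open_subtriangle_coordinates:
  assumes "z \<in> open_triangle {X, B, C}"
  obtains a b c where "z = a *\<^sub>R A + b *\<^sub>R B + c *\<^sub>R C" "a + b + c = 1" "0 < a" "a < b" "a < c"
proof -
  obtain a b c where "0 < a" "0 < b" "0 < c" "a + b + c = 1" "z = a *\<^sub>R X + b *\<^sub>R B + c *\<^sub>R C"
    using assms interior_convex_hull_3_minimal[OF noncollinear_centroid] by auto
  then show thesis using that[of "a/3" "b + a/3" "c + a/3"] by (simp add: centroid_combination)
qed

text \<open>Moving from the centroid towards \<open>A\<close> takes equal amounts from
  \<open>B\<close> and \<open>C\<close>, hence a single coefficient \<open>b\<close> for both. The
  two implications recognise the ends of the spoke from the coordinates.\<close>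

lemma spoke_coordinates:
  assumes "z \<in> closed_segment X A"
  obtains a b where "z = a *\<^sub>R A + b *\<^sub>R B + b *\<^sub>R C" "a + b + b = 1" "0 \<le> b" "b \<le> a"
    "b = a \<Longrightarrow> z = X" "b = 0 \<Longrightarrow> z = A"
proof -
  obtain u where u: "0 \<le> u" "u \<le> 1" "z = (1 - u) *\<^sub>R X + u *\<^sub>R A"
    using assms unfolding closed_segment_def by auto
  have "z = (u + (1 - u) / 3) *\<^sub>R A + ((1 - u) / 3) *\<^sub>R B + ((1 - u) / 3) *\<^sub>R C"
    unfolding u(3) centroid_eq by (simp add: scaleR_add_left scaleR_add_right)
  moreover have "z = X" if "(1 - u) / 3 = u + (1 - u) / 3" using that u(3) by simp
  moreover have "z = A" if "(1 - u) / 3 = 0" using that u(3) by simp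
  ultimately show thesis
    using u(1,2) that[of "u + (1 - u) / 3" "(1 - u) / 3"] by (simp add: field_simps)
qed

lemma centroid_in: "X \<in> open_triangle {A, B, C}"
  unfolding open_triangle_eq centroid_eq by force

lemma open_subtriangle_subset: "open_triangle {X, B, C} \<subseteq> open_triangle {A, B, C}"
  by (rule subsetI, erule open_subtriangle_coordinates, unfold open_triangle_eq) force

lemma spoke_subset: "closed_segment X A \<subseteq> insert A (open_triangle {A, B, C})"
proof
  fix z assume "z \<in> closed_segment X A"
  then show "z \<in> insert A (open_triangle {A, B, C})"
  proof (rule spoke_coordinates)
    fix a b assume z: "z = a *\<^sub>R A + b *\<^sub>R B + b *\<^sub>R C" "a + b + b = 1" "0 \<le> b" "b \<le> a"
    "b = 0 \<Longrightarrow> z = A"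
    show ?thesis
    proof (cases "b = 0")
      case False
      then show ?thesis using z unfolding open_triangle_eq by force
    qed (use z in simp)
  qed
qed

text \<open>The \<open>A\<close>-coordinate is largest on the spoke but strictly smallest in the
  subtriangle.\<close>

lemma spoke_own_open_subtriangle: "closed_segment X A \<inter> open_triangle {X, B, C} = {}"
proof (intro equals0I, elim IntE)
  fix z assume "z \<in> closed_segment X A" "z \<in> open_triangle {X, B, C}"
  then show False
    by (elim spoke_coordinates open_subtriangle_coordinates) (metis (no_types) coordinates_unique add.assoc linorder_not_less)
qed

end

text \<open>A second context with the same assumptions allows the preceding lemmas to be
  instantiated with \<open>A\<close> and \<open>B\<close> exchanged; inside the first one these
  points are fixed.\<close>

context
  fixes A B C X :: "real^2"
  assumes ncol: "\<not> collinear {A, B, C}"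
    and X: "3 *\<^sub>R X = A + B + C"
begin

lemma swapped_triangle: "\<not> collinear {B, A, C}" "3 *\<^sub>R X = B + A + C"
  using ncol X by (simp_all add: insert_commute add.commute)

text \<open>On the spoke to \<open>B\<close> the coordinates of \<open>A\<close> and
  \<open>C\<close> agree; in the subtriangle the one of \<open>A\<close> is strictly below the one
  of \<open>C\<close>.\<close>

lemma spoke_other_open_subtriangle: "closed_segment X B \<inter> open_triangle {X, B, C} = {}"
proof (intro equals0I, elim IntE)
  fix z assume "z \<in> closed_segment X B" "z \<in> open_triangle {X, B, C}"
  moreover obtain a b where "z = b *\<^sub>R B + a *\<^sub>R A + a *\<^sub>R C" "b + a + a = 1"
    using spoke_coordinates[OF swapped_triangle] calculation(1) by metis
  moreover obtain a' b' c' where "z = a' *\<^sub>R A + b' *\<^sub>R B + c' *\<^sub>R C" "a' + b' + c' = 1" "0 < a'" "a' < b'" "a' < c'"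
    using open_subtriangle_coordinates[OF ncol X] calculation(2) by metis
  ultimately show False
    using coordinates_unique[OF ncol X, of a b a a' b' c'] by (simp add: algebra_simps)
qed

lemma open_subtriangles_disjoint: "open_triangle {X, B, C} \<inter> open_triangle {X, A, C} = {}"
proof (intro equals0I, elim IntE)
  fix z assume z: "z \<in> open_triangle {X, B, C}" "z \<in> open_triangle {X, A, C}"
  obtain a b c where "z = a *\<^sub>R A + b *\<^sub>R B + c *\<^sub>R C" "a + b + c = 1" "a < b"
    using open_subtriangle_coordinates[OF ncol X z(1)] by metis
  moreover obtain a' b' c' where "z = b' *\<^sub>R B + a' *\<^sub>R A + c' *\<^sub>R C" "b' + a' + c' = 1" "b' < a'"
    using open_subtriangle_coordinates[OF swapped_triangle z(2)] by metis
  ultimately show False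
    using coordinates_unique[OF ncol X, of a b c a' b' c'] by (simp add: algebra_simps)
qed

text \<open>The inequalities of the two spokes point in opposite directions, so at a common point
  all three coordinates coincide.\<close>

lemma spokes_Int: "closed_segment X A \<inter> closed_segment X B \<subseteq> {X}"
proof (intro subsetI, elim IntE)
  fix z assume z: "z \<in> closed_segment X A" "z \<in> closed_segment X B"
  obtain a b where "z = a *\<^sub>R A + b *\<^sub>R B + b *\<^sub>R C" "a + b + b = 1" "b \<le> a" "b = a \<Longrightarrow> z = X"
    using spoke_coordinates[OF ncol X z(1)] by metis
  moreover obtain a' b' where "z = b' *\<^sub>R B + a' *\<^sub>R A + a' *\<^sub>R C" "b' + a' + a' = 1" "a' \<le> b'"
    using spoke_coordinates[OF swapped_triangle z(2)] by metis
  moreover have "a = a' \<and> b = b' \<and> b = a'"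
    using calculation by (intro coordinates_unique[OF ncol X]) (simp_all add: algebra_simps)
  ultimately show "z \<in> {X}" by simp
qed

end

text \<open>The corners form an unordered set here because the faces of the graph are sets. Any two
  distinct corners determine an ordered triple to which the coordinate lemmas apply.\<close>

lemma centroid_subdivision:
  fixes P :: "(real^2) set" and X :: "real^2"
  assumes P: "card P = 3" "\<not> collinear P" and X: "3 *\<^sub>R X = \<Sum>P"
  shows "X \<in> open_triangle P"
    and "v \<in> P \<Longrightarrow> \<not> collinear (insert X (P - {v}))"
    and "v \<in> P \<Longrightarrow> open_triangle (insert X (P - {v})) \<subseteq> open_triangle P"
    and "v \<in> P \<Longrightarrow> closed_segment X v \<subseteq> insert v (open_triangle P)"
    and "v \<in> P \<Longrightarrow> w \<in> P \<Longrightarrow> closed_segment X v \<inter> open_triangle (insert X (P - {w})) = {}"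
    and "v \<in> P \<Longrightarrow> w \<in> P \<Longrightarrow> v \<noteq> w \<Longrightarrow>
      open_triangle (insert X (P - {v})) \<inter> open_triangle (insert X (P - {w})) = {}"
    and "v \<in> P \<Longrightarrow> w \<in> P \<Longrightarrow> v \<noteq> w \<Longrightarrow> closed_segment X v \<inter> closed_segment X w \<subseteq> {X}"
proof -
  have tri: "\<exists>u. P = {v, w, u} \<and> distinct [v, w, u] \<and> 3 *\<^sub>R X = v + w + u" if "v \<in> P" "w \<in> P" "v \<noteq> w" for v w
  proof -
    have "card (P - {v, w}) = 1" using that P(1) by (simp add: card_Diff_subset)
    then obtain u where "P - {v, w} = {u}" by (auto simp: card_1_singleton_iff)
    then have "P = {v, w, u} \<and> distinct [v, w, u]" using that by auto
    then show ?thesis using X by (auto simp: add.assoc)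
  qed
  \<comment> \<open>Facts about a single corner, or about two equal corners, are obtained by
    choosing some other corner and using the facts about pairs.\<close>
  have ex: "\<exists>w\<in>P. v \<noteq> w" for v
  proof (rule ccontr)
    assume "\<not> ?thesis"
    then have "P \<subseteq> {v}" by auto
    then have "card P \<le> card {v}" by (rule card_mono[rotated]) simp
    then show False using P(1) by simp
  qed
  {
    fix v w assume "v \<in> P" "w \<in> P" "v \<noteq> w"
    then obtain u where u: "P = {v, w, u}" "distinct [v, w, u]" "3 *\<^sub>R X = v + w + u"
      using tri by blast
    have d: "P - {v} = {w, u}" "P - {w} = {v, u}" using u by auto
    note * = P(2)[unfolded u(1)] u(3)
    show "open_triangle (insert X (P - {v})) \<inter> open_triangle (insert X (P - {w})) = {}"
      unfolding d by (rule open_subtriangles_disjoint[OF *])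
    show "closed_segment X v \<inter> closed_segment X w \<subseteq> {X}"
      by (rule spokes_Int[OF *])
    have "X \<in> open_triangle P"
      unfolding u(1) by (rule centroid_in[OF *])
    moreover have "\<not> collinear (insert X (P - {v}))"
      unfolding d by (rule noncollinear_centroid[OF *])
    moreover have "open_triangle (insert X (P - {v})) \<subseteq> open_triangle P"
      unfolding d unfolding u(1) by (rule open_subtriangle_subset[OF *])
    moreover have "closed_segment X v \<subseteq> insert v (open_triangle P)"
      unfolding u(1) by (rule spoke_subset[OF *])
    moreover have "closed_segment X v \<inter> open_triangle (insert X (P - {v})) = {}"
      unfolding d by (rule spoke_own_open_subtriangle[OF *])
    moreover have "closed_segment X w \<inter> open_triangle (insert X (P - {v})) = {}"
      unfolding d by (rule spoke_other_open_subtriangle[OF *])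
    ultimately have "X \<in> open_triangle P \<and> \<not> collinear (insert X (P - {v})) \<and>
        open_triangle (insert X (P - {v})) \<subseteq> open_triangle P \<and>
        closed_segment X v \<subseteq> insert v (open_triangle P) \<and>
        closed_segment X v \<inter> open_triangle (insert X (P - {v})) = {} \<and>
        closed_segment X w \<inter> open_triangle (insert X (P - {v})) = {}"
      by (intro conjI)
  } note pair = this
  have "P \<noteq> {}" using P(1) by auto
  then show "X \<in> open_triangle P" using ex pair by metis
  show "\<not> collinear (insert X (P - {v}))" if "v \<in> P" using ex[of v] pair[of v] that by metis
  show "open_triangle (insert X (P - {v})) \<subseteq> open_triangle P" if "v \<in> P"
    using ex[of v] pair[of v] that by metis
  show "closed_segment X v \<subseteq> insert v (open_triangle P)" if "v \<in> P"
    using ex[of v] pair[of v] that by metis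
  show "closed_segment X v \<inter> open_triangle (insert X (P - {w})) = {}" if "v \<in> P" "w \<in> P"
    using ex[of v] pair[of v] pair[of w v] that by metis
qed

section \<open>Planar 3-trees with their bounded faces\<close>

text \<open>The third argument records the bounded faces, since a triangle of the graph need not be
  a face: after stacking, \<open>t\<close> is still a triangle but is no longer available.\<close>

inductive stacked :: "'a set \<Rightarrow> 'a set set \<Rightarrow> 'a set set \<Rightarrow> bool" where
  triangle: "card t = 3 \<Longrightarrow> stacked t {{u, v} |u v. u \<in> t \<and> v \<in> t \<and> u \<noteq> v} {t}"
| stack: "stacked V E F \<Longrightarrow> t \<in> F \<Longrightarrow> x \<notin> V \<Longrightarrow>
    stacked (insert x V) (E \<union> (\<lambda>a. {x, a}) ` t) (F - {t} \<union> (\<lambda>a. insert x (t - {a})) ` t)"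

lemma stacked_wf:
  assumes "stacked V E F"
  shows "sgraph V E \<and> (\<forall>t\<in>F. t \<subseteq> V \<and> card t = 3 \<and> (\<forall>u\<in>t. \<forall>v\<in>t. u \<noteq> v \<longrightarrow> {u, v} \<in> E))"
  using assms
proof induction
  case (triangle t)
  then show ?case unfolding sgraph_def by (auto intro: card_ge_0_finite)
next
  case (stack V E F t x)
  have V: "finite V" and E: "\<And>e. e \<in> E \<Longrightarrow> \<exists>u v. e = {u, v} \<and> u \<noteq> v \<and> u \<in> V \<and> v \<in> V"
    using stack.IH by (simp_all add: sgraph_def)
  have F: "s \<subseteq> V" "card s = 3" "\<And>u v. u \<in> s \<Longrightarrow> v \<in> s \<Longrightarrow> u \<noteq> v \<Longrightarrow> {u, v} \<in> E" if "s \<in> F" for s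
    using stack.IH that by simp_all
  note t = F[OF stack.hyps(2)]
  have "finite t" using t(2) by (simp add: card_ge_0_finite)
  have edges: "\<exists>u v. e = {u, v} \<and> u \<noteq> v \<and> u \<in> insert x V \<and> v \<in> insert x V"
    if "e \<in> E \<union> (\<lambda>a. {x, a}) ` t" for e
  proof (cases "e \<in> E")
    case True
    then show ?thesis using E[of e] by auto
  next
    case False
    with that have "e \<in> (\<lambda>a. {x, a}) ` t" by blast
    then obtain a where "e = {x, a}" "a \<in> t" by blast
    moreover have "a \<in> V" using \<open>a \<in> t\<close> t(1) by blast
    ultimately show ?thesis using stack.hyps(3) by (intro exI[of _ x] exI[of _ a]) auto
  qed
  have faces: "s \<subseteq> insert x V \<and> card s = 3 \<and>
      (\<forall>u\<in>s. \<forall>v\<in>s. u \<noteq> v \<longrightarrow> {u, v} \<in> E \<union> (\<lambda>a. {x, a}) ` t)"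
    if s: "s \<in> F - {t} \<union> (\<lambda>a. insert x (t - {a})) ` t" for s
  proof (cases "s \<in> F")
    case True
    then show ?thesis using F[of s] by auto
  next
    case False
    with s have "s \<in> (\<lambda>a. insert x (t - {a})) ` t" by blast
    then obtain a where a: "s = insert x (t - {a})" "a \<in> t" by blast
    have "{u, v} \<in> E \<union> (\<lambda>a. {x, a}) ` t" if "u \<in> s" "v \<in> s" "u \<noteq> v" for u v
    proof -
      consider "u = x" "v \<in> t" | "v = x" "u \<in> t" | "u \<in> t" "v \<in> t"
        using \<open>u \<in> s\<close> \<open>v \<in> s\<close> \<open>u \<noteq> v\<close> unfolding a(1) by blast
      then show ?thesis
        by cases (use t(3)[of u v] that(3) in \<open>auto simp: insert_commute\<close>)
    qed
    moreover have "card s = 3"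
      using t \<open>finite t\<close> a stack.hyps(3) by (subst a(1), subst card_insert_disjoint) auto
    moreover have "s \<subseteq> insert x V" using a(1) t(1) by blast
    ultimately show ?thesis by blast
  qed
  show ?case
    unfolding sgraph_def using V edges faces by simp
qed

lemma stackedD:
  assumes "stacked V E F"
  shows "sgraph V E" and "e \<in> E \<Longrightarrow> e \<subseteq> V" and "t \<in> F \<Longrightarrow> t \<subseteq> V" and "t \<in> F \<Longrightarrow> card t = 3"
    and "t \<in> F \<Longrightarrow> u \<in> t \<Longrightarrow> v \<in> t \<Longrightarrow> u \<noteq> v \<Longrightarrow> {u, v} \<in> E"
proof -
  note wf = stacked_wf[OF assms]
  show "sgraph V E" using wf by (rule conjunct1)
  then show "e \<subseteq> V" if "e \<in> E" using that by (fastforce simp: sgraph_def)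
  show "t \<subseteq> V" "card t = 3" if "t \<in> F" using wf that by simp_all
  show "{u, v} \<in> E" if "t \<in> F" "u \<in> t" "v \<in> t" "u \<noteq> v" using wf that by simp
qed

text \<open>When \<open>t\<close> is subdivided, each of its edges survives in the new face that
  omits the corner opposite to it. This is what allows gadgets to be attached repeatedly to one
  edge.\<close>

lemma stacked_face_of_edge:
  assumes "stacked V E F" "e \<in> E"
  shows "\<exists>t\<in>F. e \<subseteq> t"
  using assms
proof (induction arbitrary: e)
  case (stack V E F t x)
  note t = stackedD(4)[OF stack.hyps(1,2)]
  have third: "\<exists>w\<in>t. w \<noteq> u \<and> w \<noteq> v" for u v
  proof (rule ccontr)
    assume "\<not> ?thesis"
    then have "t \<subseteq> {u, v}" by auto
    then have "card t \<le> card {u, v}" by (rule card_mono[rotated]) simp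
    then show False using t card_insert_le_m1[of 2 "{v}" u] by simp
  qed
  have cover: "(\<exists>s\<in>F. s \<noteq> t \<and> e \<subseteq> s) \<or> (\<exists>u v. e = {u, v} \<and> e \<subseteq> t)" if "e \<in> E"
  proof -
    have "\<exists>s\<in>F. e \<subseteq> s" using that by (rule stack.IH)
    moreover have "\<exists>u v. e = {u, v}"
      using bspec[OF conjunct2[OF stackedD(1)[OF stack.hyps(1), unfolded sgraph_def]] that] by blast
    ultimately show ?thesis by (cases "\<exists>s\<in>F. s \<noteq> t \<and> e \<subseteq> s") blast+
  qed
  consider s where "s \<in> F" "s \<noteq> t" "e \<subseteq> s" | u v where "e = {u, v}" "e \<subseteq> t" | a where "e = {x, a}" "a \<in> t"
    using stack.prems cover by blast
  then show ?case
  proof cases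
    case 2
    obtain w where "w \<in> t" "w \<noteq> u" "w \<noteq> v" using third by blast
    then have "insert x (t - {w}) \<in> F - {t} \<union> (\<lambda>a. insert x (t - {a})) ` t" "e \<subseteq> insert x (t - {w})"
      using 2 by auto
    then show ?thesis by (rule bexI[rotated])
  next
    case 3
    obtain w where "w \<in> t" "w \<noteq> a" using third by blast
    then have "insert x (t - {w}) \<in> F - {t} \<union> (\<lambda>a. insert x (t - {a})) ` t" "e \<subseteq> insert x (t - {w})"
      using 3 by auto
    then show ?thesis by (rule bexI[rotated])
  qed blast
qed blast

lemma stacked_face_of_vertex:
  assumes "stacked V E F" "v \<in> V"
  shows "\<exists>t\<in>F. v \<in> t"
proof -
  have "\<exists>e\<in>E. v \<in> e" using assms
  proof induction
    case (triangle t)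
    have "t \<noteq> {v}" using triangle by auto
    then obtain u where "u \<in> t" "u \<noteq> v" using triangle.prems by blast
    then show ?case using triangle.prems by blast
  next
    case (stack V E F t x)
    have "t \<noteq> {}" using stackedD(4)[OF stack.hyps(1,2)] by auto
    then show ?case using stack by blast
  qed
  then show ?thesis using stacked_face_of_edge[OF assms(1)] by blast
qed

section \<open>The Tromp graph as a universal target\<close>

text \<open>The points \<open>0, \<dots>, 8\<close> form a 3-by-3 grid, and a pair is positive iff it shares a row or a column
(the Paley graph of order 9); the point \<open>9\<close> is joined positively to all of them.\<close>

definition paley_neg :: "nat \<Rightarrow> nat \<Rightarrow> bool" where
  "paley_neg j k \<longleftrightarrow> j \<noteq> 9 \<and> k \<noteq> 9 \<and> j div 3 \<noteq> k div 3 \<and> j mod 3 \<noteq> k mod 3"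

text \<open>Up to switching, the ten points form the conference two-graph that arises from the Paley
  graph of order 9. Only agreement with the sign towards \<open>j\<close> is prescribed, a condition
  that is unchanged when all three signs are reversed.\<close>

lemma paley_neg_extension:
  fixes j k l :: nat
  assumes "j < 10" "k < 10" "l < 10" "j \<noteq> k" "j \<noteq> l" "k \<noteq> l"
  obtains m where "m < 10" "m \<noteq> j" "m \<noteq> k" "m \<noteq> l"
    "paley_neg m j = paley_neg m k \<longleftrightarrow> \<beta>" "paley_neg m j = paley_neg m l \<longleftrightarrow> \<gamma>"
proof -
  \<comment> \<open>The quantifiers range over explicit lists, which makes the statement
    executable.\<close>
  have table: "\<forall>j\<in>set [0..<10]. \<forall>k\<in>set [0..<10]. \<forall>l\<in>set [0..<10]. j \<noteq> k \<longrightarrow> j \<noteq> l \<longrightarrow> k \<noteq> l \<longrightarrow>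
    (\<forall>\<beta>\<in>set [True, False]. \<forall>\<gamma>\<in>set [True, False]. \<exists>m\<in>set [0..<10]. m \<noteq> j \<and> m \<noteq> k \<and> m \<noteq> l \<and>
      (paley_neg m j = paley_neg m k) = \<beta> \<and> (paley_neg m j = paley_neg m l) = \<gamma>)"
    by code_simp
  have "\<exists>m\<in>set [0..<10]. m \<noteq> j \<and> m \<noteq> k \<and> m \<noteq> l \<and>
      (paley_neg m j = paley_neg m k) = \<beta> \<and> (paley_neg m j = paley_neg m l) = \<gamma>"
    by (rule table[rule_format]) (use assms in auto)
  then obtain m where m: "m \<in> set [0..<10]" "m \<noteq> j" "m \<noteq> k" "m \<noteq> l"
      "(paley_neg m j = paley_neg m k) = \<beta>" "(paley_neg m j = paley_neg m l) = \<gamma>"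
    by blast
  show thesis by (rule that[of m]) (use m in simp_all)
qed

text \<open>Every point \<open>j < 10\<close> is doubled to \<open>2 * j\<close> and \<open>2 * j + 1\<close>, the second copy with all signs reversed.
Because both copies are available, only the products of the prescribed signs matter when a vertex
is to be attached to a triangle; this reduces the extension property to \<open>paley_neg_extension\<close>.\<close>

definition tromp_neg :: "nat \<Rightarrow> nat \<Rightarrow> bool" where
  "tromp_neg m n \<longleftrightarrow> paley_neg (m div 2) (n div 2) \<noteq> (odd m \<noteq> odd n)"

definition tromp_edges :: "nat set set" where
  "tromp_edges = {{m, n} |m n. m < 20 \<and> n < 20 \<and> m div 2 \<noteq> n div 2}"

definition tromp_neg_edges :: "nat set set" where
  "tromp_neg_edges = {{m, n} |m n. m < 20 \<and> n < 20 \<and> m div 2 \<noteq> n div 2 \<and> tromp_neg m n}"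

lemma tromp_edges_iff: "{m, n} \<in> tromp_edges \<longleftrightarrow> m < 20 \<and> n < 20 \<and> m div 2 \<noteq> n div 2"
  unfolding tromp_edges_def by (auto simp: doubleton_eq_iff)

lemma tromp_neg_edges_iff:
  "{m, n} \<in> tromp_neg_edges \<longleftrightarrow> m < 20 \<and> n < 20 \<and> m div 2 \<noteq> n div 2 \<and> tromp_neg m n"
proof -
  have "tromp_neg m n = tromp_neg n m" for m n
    unfolding tromp_neg_def paley_neg_def by auto
  then show ?thesis
    unfolding tromp_neg_edges_def by (auto simp: doubleton_eq_iff)
qed

lemma sgraph_tromp: "sgraph {..<20} tromp_edges"
  unfolding sgraph_def tromp_edges_def by auto

lemma tromp_neg_edges_subset: "tromp_neg_edges \<subseteq> tromp_edges"
  unfolding tromp_edges_def tromp_neg_edges_def by auto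

lemma tromp_extension:
  assumes "{x, y} \<in> tromp_edges" "{x, z} \<in> tromp_edges" "{y, z} \<in> tromp_edges"
  obtains w where "w < 20"
    "{w, x} \<in> tromp_edges" "{w, x} \<in> tromp_neg_edges \<longleftrightarrow> \<alpha>"
    "{w, y} \<in> tromp_edges" "{w, y} \<in> tromp_neg_edges \<longleftrightarrow> \<beta>"
    "{w, z} \<in> tromp_edges" "{w, z} \<in> tromp_neg_edges \<longleftrightarrow> \<gamma>"
proof -
  have 1: "x < 20" "y < 20" "z < 20" "x div 2 \<noteq> y div 2" "x div 2 \<noteq> z div 2" "y div 2 \<noteq> z div 2"
    using assms by (auto simp: tromp_edges_iff)
  then have "x div 2 < 10" "y div 2 < 10" "z div 2 < 10" by auto
  \<comment> \<open>The parity of \<open>w\<close> cancels when its signs towards two vertices are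
    compared, so the agreement of two prescribed signs is a condition on \<open>m\<close> alone,
    corrected by the parities of the given vertices.\<close>
  then obtain m where m: "m < 10" "m \<noteq> x div 2" "m \<noteq> y div 2" "m \<noteq> z div 2"
    "paley_neg m (x div 2) = paley_neg m (y div 2) \<longleftrightarrow> ((\<alpha> = \<beta>) = (odd x = odd y))"
    "paley_neg m (x div 2) = paley_neg m (z div 2) \<longleftrightarrow> ((\<alpha> = \<gamma>) = (odd x = odd z))"
    by (rule paley_neg_extension[OF _ _ _ 1(4-6), where
        \<beta> = "(\<alpha> = \<beta>) = (odd x = odd y)" and \<gamma> = "(\<alpha> = \<gamma>) = (odd x = odd z)"])
  \<comment> \<open>The copy of \<open>m\<close> is chosen to give the right sign towards
    \<open>x\<close>; the two agreement conditions then settle \<open>y\<close> and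
    \<open>z\<close>.\<close>
  define w where "w = (if paley_neg m (x div 2) = (\<alpha> = odd x) then 2 * m + 1 else 2 * m)"
  have w: "w < 20" "w div 2 = m" "odd w \<longleftrightarrow> paley_neg m (x div 2) = (\<alpha> = odd x)"
    using m(1) unfolding w_def by auto
  have "tromp_neg w x = \<alpha>" "tromp_neg w y = \<beta>" "tromp_neg w z = \<gamma>"
    using w(3) m(5,6) unfolding tromp_neg_def w(2) by (argo, argo, argo)
  then show thesis
    using that[of w] w(1,2) m(2-4) 1(1-3) by (simp add: tromp_edges_iff tromp_neg_edges_iff)
qed

lemma stacked_hom_tromp:
  assumes "stacked V E F"
  shows "\<exists>f. sig_hom V E S {..<20} tromp_edges tromp_neg_edges f"
  using assms
proof induction
  case (triangle t)
  obtain a b c where abc: "t = {a, b, c}" "a \<noteq> b" "a \<noteq> c" "b \<noteq> c"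
    using triangle by (auto simp: card_3_iff)
  \<comment> \<open>The extension property applies only to triangles of the target, so an auxiliary
    triangle at 0 is used to find an image for \<open>b\<close>.\<close>
  have "{0, 2} \<in> tromp_edges" "{0, 4} \<in> tromp_edges" "{2, 4} \<in> tromp_edges"
    by (auto simp: tromp_edges_iff)
  then obtain y where y: "y < 20" "{y, 0} \<in> tromp_edges"
    "{y, 0} \<in> tromp_neg_edges \<longleftrightarrow> {b, a} \<in> S"
    by (rule tromp_extension[where \<alpha> = "{b, a} \<in> S"])
  \<comment> \<open>An auxiliary third vertex whose underlying point differs from those of 0 and
    \<open>y\<close>, so that the extension property applies again and gives an image for
    \<open>c\<close>.\<close>
  define w where "w = (if y div 2 = 1 then 4 else 2 :: nat)"
  have "{w, 0} \<in> tromp_edges" "{w, y} \<in> tromp_edges" "{0, y} \<in> tromp_edges"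
    using y(1,2) by (auto simp: w_def tromp_edges_iff)
  then obtain z where z: "z < 20" "{z, 0} \<in> tromp_edges" "{z, 0} \<in> tromp_neg_edges \<longleftrightarrow> {c, a} \<in> S"
    "{z, y} \<in> tromp_edges" "{z, y} \<in> tromp_neg_edges \<longleftrightarrow> {c, b} \<in> S"
    by (rule tromp_extension[where \<beta> = "{c, a} \<in> S" and \<gamma> = "{c, b} \<in> S"])
  define f where "f v = (if v = a then 0 else if v = b then y else z)" for v
  have f: "f a = 0" "f b = y" "f c = z" using abc(2-) by (auto simp: f_def)
  have "f ` e \<in> tromp_edges \<and> (f ` e \<in> tromp_neg_edges \<longleftrightarrow> e \<in> S)"
    if "e \<in> {{u, v} |u v. u \<in> t \<and> v \<in> t \<and> u \<noteq> v}" for e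
  proof -
    have "e = {b, a} \<or> e = {c, a} \<or> e = {c, b}" using that abc(1) by auto
    then show ?thesis using y z by (auto simp: f)
  qed
  moreover have "f ` t \<subseteq> {..<20}" using y(1) z(1) by (simp add: abc(1) f)
  ultimately have "sig_hom t {{u, v} |u v. u \<in> t \<and> v \<in> t \<and> u \<noteq> v} S {..<20} tromp_edges tromp_neg_edges f"
    unfolding sig_hom_def by blast
  then show ?case by blast
next
  case (stack V E F t x)
  then obtain f where f: "sig_hom V E S {..<20} tromp_edges tromp_neg_edges f" by blast
  note wf = stackedD(2)[OF stack.hyps(1)]
  note t = stackedD(3-5)[OF stack.hyps(1,2)]
  obtain a b c where abc: "t = {a, b, c}" "a \<noteq> b" "a \<noteq> c" "b \<noteq> c"
    using t(2) by (auto simp: card_3_iff)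
  have "f ` {a, b} \<in> tromp_edges" "f ` {a, c} \<in> tromp_edges" "f ` {b, c} \<in> tromp_edges"
    using f t(3) abc unfolding sig_hom_def by blast+
  then have "{f a, f b} \<in> tromp_edges" "{f a, f c} \<in> tromp_edges" "{f b, f c} \<in> tromp_edges"
    by simp_all
  then obtain w where w: "w < 20"
    "{w, f a} \<in> tromp_edges" "{w, f a} \<in> tromp_neg_edges \<longleftrightarrow> {x, a} \<in> S"
    "{w, f b} \<in> tromp_edges" "{w, f b} \<in> tromp_neg_edges \<longleftrightarrow> {x, b} \<in> S"
    "{w, f c} \<in> tromp_edges" "{w, f c} \<in> tromp_neg_edges \<longleftrightarrow> {x, c} \<in> S"
    by (rule tromp_extension[where \<alpha> = "{x, a} \<in> S" and \<beta> = "{x, b} \<in> S" and \<gamma> = "{x, c} \<in> S"])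
  have old: "(f(x := w)) ` e = f ` e" if "e \<subseteq> V" for e
    using that stack.hyps(3) by (intro image_cong) auto
  have new: "f(x := w) ` {x, v} = {w, f v}" if "v \<in> t" for v
    using that t(1) stack.hyps(3) by auto
  have "sig_hom (insert x V) (E \<union> (\<lambda>a. {x, a}) ` t) S {..<20} tromp_edges tromp_neg_edges (f(x := w))"
    unfolding sig_hom_def
  proof (intro conjI ballI)
    show "(f(x := w)) ` insert x V \<subseteq> {..<20}"
      using f w(1) unfolding sig_hom_def by auto
    fix e assume "e \<in> E \<union> (\<lambda>a. {x, a}) ` t"
    then consider "e \<in> E" | v where "v \<in> t" "e = {x, v}" by blast
    then have "(f(x := w)) ` e \<in> tromp_edges \<and> ((f(x := w)) ` e \<in> tromp_neg_edges \<longleftrightarrow> e \<in> S)"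
    proof cases
      case 1
      then show ?thesis using f old[OF wf] unfolding sig_hom_def by simp
    next
      case 2
      then show ?thesis using new[of v] w abc(1) by auto
    qed
    then show "(f(x := w)) ` e \<in> tromp_edges" "((f(x := w)) ` e \<in> tromp_neg_edges) = (e \<in> S)"
      by blast+
  qed
  then show ?case by blast
qed

section \<open>Straight-line drawings\<close>

text \<open>The first three conditions are planarity with segments as arcs. The last three are the
  strengthening that the induction needs: bounded faces are genuine triangles with empty, pairwise
  disjoint interiors, so there is room to stack again. Convex hulls represent segments without
  ordering the ends of an edge.\<close>

definition straight_drawing ::
  "('a \<Rightarrow> real^2) \<Rightarrow> 'a set \<Rightarrow> 'a set set \<Rightarrow> 'a set set \<Rightarrow> bool" where
  "straight_drawing p V E F \<longleftrightarrow> inj_on p V \<and>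
     (\<forall>e\<in>E. \<forall>w\<in>V. p w \<in> convex hull (p ` e) \<longrightarrow> w \<in> e) \<and>
     (\<forall>e\<in>E. \<forall>e'\<in>E. e \<noteq> e' \<longrightarrow> convex hull (p ` e) \<inter> convex hull (p ` e') \<subseteq> p ` (e \<inter> e')) \<and>
     (\<forall>t\<in>F. \<not> collinear (p ` t)) \<and>
     (\<forall>t\<in>F. open_triangle (p ` t) \<inter> (p ` V \<union> (\<Union>e\<in>E. convex hull (p ` e))) = {}) \<and>
     (\<forall>t\<in>F. \<forall>t'\<in>F. t \<noteq> t' \<longrightarrow> open_triangle (p ` t) \<inter> open_triangle (p ` t') = {})"

lemma straight_drawingD:
  assumes "straight_drawing p V E F"
  shows "inj_on p V"
    and "e \<in> E \<Longrightarrow> w \<in> V \<Longrightarrow> p w \<in> convex hull (p ` e) \<Longrightarrow> w \<in> e"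
    and "e \<in> E \<Longrightarrow> e' \<in> E \<Longrightarrow> e \<noteq> e' \<Longrightarrow>
      convex hull (p ` e) \<inter> convex hull (p ` e') \<subseteq> p ` (e \<inter> e')"
    and "t \<in> F \<Longrightarrow> \<not> collinear (p ` t)"
    and "t \<in> F \<Longrightarrow> v \<in> V \<Longrightarrow> p v \<notin> open_triangle (p ` t)"
    and "t \<in> F \<Longrightarrow> e \<in> E \<Longrightarrow> open_triangle (p ` t) \<inter> convex hull (p ` e) = {}"
    and "t \<in> F \<Longrightarrow> t' \<in> F \<Longrightarrow> t \<noteq> t' \<Longrightarrow> open_triangle (p ` t) \<inter> open_triangle (p ` t') = {}"
proof -
  note d = assms[unfolded straight_drawing_def]
  show "inj_on p V" using d by (rule conjunct1)
  show "w \<in> e" if "e \<in> E" "w \<in> V" "p w \<in> convex hull (p ` e)" using d that by simp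
  show "convex hull (p ` e) \<inter> convex hull (p ` e') \<subseteq> p ` (e \<inter> e')" if "e \<in> E" "e' \<in> E" "e \<noteq> e'"
    using d that by simp
  show "\<not> collinear (p ` t)" if "t \<in> F" using d that by simp
  have free: "open_triangle (p ` t) \<inter> (p ` V \<union> (\<Union>e\<in>E. convex hull (p ` e))) = {}" if "t \<in> F"
    using d that by simp
  show "p v \<notin> open_triangle (p ` t)" if "t \<in> F" "v \<in> V"
    using free that by blast
  show "open_triangle (p ` t) \<inter> convex hull (p ` e) = {}" if "t \<in> F" "e \<in> E"
    using free that by blast
  show "open_triangle (p ` t) \<inter> open_triangle (p ` t') = {}" if "t \<in> F" "t' \<in> F" "t \<noteq> t'"
    using d that by simp
qed

lemma straight_drawing_triangle:
  assumes "card t = 3"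
  shows "\<exists>p. straight_drawing p t {{u, v} |u v. u \<in> t \<and> v \<in> t \<and> u \<noteq> v} {t}"
proof -
  obtain a b c where abc: "t = {a, b, c}" "a \<noteq> b" "a \<noteq> c" "b \<noteq> c"
    using assms by (auto simp: card_3_iff)
  define A B C :: "real^2" where "A = 0" and "B = axis 1 1" and "C = axis 2 1"
  have "\<not> collinear {A, B, C}"
  proof
    assume "collinear {A, B, C}"
    moreover have "A \<noteq> B" "A \<noteq> C" "B \<noteq> C"
      by (auto simp: A_def B_def C_def axis_eq_axis axis_eq_0_iff)
    ultimately obtain k where "C = k *\<^sub>R B"
      unfolding A_def collinear_lemma by (metis scaleR_zero_left)
    then have "C $ 2 = k * B $ 2" by simp
    then show False by (simp add: B_def C_def axis_def)
  qed
  then have ncol: "\<not> collinear {A, B, C}" "\<not> collinear {B, A, C}" "\<not> collinear {C, A, B}"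
    "A \<noteq> B" "A \<noteq> C" "B \<noteq> C"
    by (auto simp: insert_commute)
  have *: "\<not> affine_dependent {A, B, C}"
    using ncol by (auto simp: collinear_3_eq_affine_dependent)
  define p where "p v = (if v = a then A else if v = b then B else C)" for v
  have p: "p a = A" "p b = B" "p c = C" "p ` t = {A, B, C}"
    using abc by (auto simp: p_def)
  have inj: "inj_on p t" using abc ncol by (auto simp: inj_on_def p_def)
  have sub: "\<not> affine_dependent (p ` t)" unfolding p by (rule *)
  \<comment> \<open>For affinely independent points, hulls of subsets meet exactly in the hull of
    the common points; this covers all incidences of vertices and edges.\<close>
  have faces: "convex hull X \<inter> convex hull Y = convex hull (X \<inter> Y)" if "X \<subseteq> p ` t" "Y \<subseteq> p ` t" for X Y
  proof -
    have "\<not> affine_dependent (X \<union> Y)" by (rule affine_independent_subset[OF sub]) (use that in blast)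
    then show ?thesis by (rule convex_hull_Int[symmetric])
  qed
  have edge: "e \<subseteq> t \<and> card e = 2" if "e \<in> {{u, v} |u v. u \<in> t \<and> v \<in> t \<and> u \<noteq> v}" for e
    using that by auto
  \<comment> \<open>The hull of a proper subset of the corners is a proper face of the triangle and
    hence misses its interior.\<close>
  have open_tri: "open_triangle (p ` t) \<inter> convex hull (p ` s) = {}" if "s \<subset> t" for s
  proof -
    have "\<exists>v. v \<in> t \<and> v \<notin> s" using that by blast
    then obtain v where v: "v \<in> t" "v \<notin> s" by blast
    have "convex hull (p ` {v}) \<inter> convex hull (p ` s) = convex hull (p ` {v} \<inter> p ` s)"
      using that v(1) by (intro faces) auto
    also have "p ` {v} \<inter> p ` s = {}"
      using inj v that by (auto simp: inj_on_def)
    finally have "p v \<notin> convex hull (p ` s)" by simp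
    moreover have "p v \<in> convex hull (p ` t)" using v(1) by (simp add: hull_inc)
    ultimately have "convex hull (p ` s) \<noteq> convex hull (p ` t)" by blast
    moreover have "convex hull (p ` s) face_of convex hull (p ` t)"
      unfolding face_of_convex_hull_affine_independent[OF sub] using that by blast
    ultimately show ?thesis
      using face_of_disjoint_interior[of "convex hull (p ` s)" "convex hull (p ` t)"] by blast
  qed
  have "straight_drawing p t {{u, v} |u v. u \<in> t \<and> v \<in> t \<and> u \<noteq> v} {t}"
    unfolding straight_drawing_def
  proof (intro conjI ballI impI)
    show "inj_on p t" by (rule inj)
  next
    fix e w assume "e \<in> {{u, v} |u v. u \<in> t \<and> v \<in> t \<and> u \<noteq> v}" "w \<in> t" "p w \<in> convex hull (p ` e)"
    then have "p w \<in> convex hull (p ` {w}) \<inter> convex hull (p ` e)" "e \<subseteq> t" using edge by auto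
    then have "p ` {w} \<inter> p ` e \<noteq> {}" using faces[of "p ` {w}" "p ` e"] \<open>w \<in> t\<close> by fastforce
    then show "w \<in> e" using inj \<open>e \<subseteq> t\<close> \<open>w \<in> t\<close> by (auto simp: inj_on_def)
  next
    fix e e' assume e: "e \<in> {{u, v} |u v. u \<in> t \<and> v \<in> t \<and> u \<noteq> v}"
      "e' \<in> {{u, v} |u v. u \<in> t \<and> v \<in> t \<and> u \<noteq> v}" "e \<noteq> e'"
    then have sub: "e \<subseteq> t" "e' \<subseteq> t" "card e = 2" "card e' = 2" using edge by auto
    obtain u v where uv: "e = {u, v}" using e(1) by blast
    have "\<not> e \<subseteq> e'"
      using sub e(3) card_subset_eq[of e' e] finite_subset[OF sub(2)] abc(1) by auto
    then have "e \<inter> e' = {} \<or> (\<exists>z. e \<inter> e' = {z})" using uv by blast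
    then have "convex hull (p ` (e \<inter> e')) = p ` (e \<inter> e')" by (elim disjE exE) simp_all
    then show "convex hull (p ` e) \<inter> convex hull (p ` e') \<subseteq> p ` (e \<inter> e')"
      using faces[of "p ` e" "p ` e'"] sub inj_on_image_Int[OF inj sub(1,2)] by (simp add: image_mono)
  next
    fix s assume "s \<in> {t}"
    then show "\<not> collinear (p ` s)" using p ncol by simp
    have "p v \<notin> open_triangle (p ` t)" if "v \<in> t" for v
      using open_tri[of "{v}"] that abc by auto
    moreover have "open_triangle (p ` t) \<inter> convex hull (p ` e) = {}"
      if "e \<in> {{u, v} |u v. u \<in> t \<and> v \<in> t \<and> u \<noteq> v}" for e
      using edge[OF that] assms by (intro open_tri) auto
    ultimately show "open_triangle (p ` s) \<inter>
        (p ` t \<union> (\<Union>e\<in>{{u, v} |u v. u \<in> t \<and> v \<in> t \<and> u \<noteq> v}. convex hull (p ` e))) = {}"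
      unfolding singletonD[OF \<open>s \<in> {t}\<close>] Int_Un_distrib Int_UN_distrib
      by (intro Un_empty[THEN iffD2] conjI SUP_bot_conv(1)[THEN iffD2] ballI) auto
  qed auto
  then show ?thesis by blast
qed

text \<open>Everything new lies in the open triangle of \<open>t\<close>, apart from the corners
  where the spokes end. That triangle is free of the old drawing, so old and new parts can meet only
  in corners; the new parts among themselves are handled by
  \<open>centroid_subdivision\<close>.\<close>

lemma straight_drawing_stack:
  fixes p :: "'a \<Rightarrow> real^2"
  assumes draw: "straight_drawing p V E F" and t: "t \<in> F" "card t = 3" and x: "x \<notin> V"
    and EV: "\<And>e. e \<in> E \<Longrightarrow> e \<subseteq> V" and FV: "\<And>s. s \<in> F \<Longrightarrow> s \<subseteq> V"
  shows "\<exists>X. straight_drawing (p(x := X)) (insert x V) (E \<union> (\<lambda>a. {x, a}) ` t)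
    (F - {t} \<union> (\<lambda>a. insert x (t - {a})) ` t)"
proof -
  define X where "X = (1/3) *\<^sub>R \<Sum>(p ` t)"
  define q where "q = p(x := X)"
  define Q where "Q = p ` t"
  define H where "H e = convex hull (q ` e)" for e
  define T where "T s = open_triangle (q ` s)" for s
  have tV: "t \<subseteq> V" and xt: "x \<notin> t" using FV t x by auto
  have old: "q ` s = p ` s" if "s \<subseteq> V" for s
    using that x unfolding q_def by (intro image_cong) auto
  have qv: "q v = p v" if "v \<in> V" for v using that x unfolding q_def by auto
  have qx: "q x = X" by (simp add: q_def)
  note D = straight_drawingD[OF draw]
  note inj = D(1)
  have Q: "card Q = 3" "\<not> collinear Q"
    using t(2) card_image[OF inj_on_subset[OF inj tV]] D(4)[OF t(1)] by (simp_all add: Q_def)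
  have X3: "3 *\<^sub>R X = \<Sum>Q" by (simp add: X_def Q_def)
  note sub = centroid_subdivision[OF Q X3]
  have Ot: "T t = open_triangle Q" using old[OF tV] by (simp add: T_def Q_def)
  have spoke: "H {x, a} = closed_segment X (p a)" if "a \<in> t" for a
    using that qv[of a] tV qx by (auto simp: H_def segment_convex_hull)
  have new_face: "q ` insert x (t - {a}) = insert X (Q - {p a})" if "a \<in> t" for a
  proof -
    have "q ` (t - {a}) = p ` (t - {a})" using tV by (intro old) blast
    also have "\<dots> = Q - {p a}"
      unfolding Q_def using tV that by (subst inj_on_image_set_diff[OF inj]) auto
    finally show ?thesis by (simp add: qx)
  qed
  have E_H: "H e = convex hull (p ` e)" if "e \<in> E" for e
    using old[OF EV[OF that]] by (simp add: H_def)
  have F_T: "T s = open_triangle (p ` s)" if "s \<in> F" for s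
    using old[OF FV[OF that]] by (simp add: T_def)
  have d1: "w \<in> e" if "e \<in> E" "w \<in> V" "p w \<in> H e" for e w
    using D(2) that unfolding E_H[OF that(1)] by blast
  have d2: "H e \<inter> H e' \<subseteq> q ` (e \<inter> e')" if "e \<in> E" "e' \<in> E" "e \<noteq> e'" for e e'
  proof -
    have "q ` (e \<inter> e') = p ` (e \<inter> e')" using EV[OF that(1)] by (intro old) blast
    then show ?thesis using D(3)[OF that] E_H that by simp
  qed
  have d3: "T s \<inter> H e = {}" if "s \<in> F" "e \<in> E" for s e
    using D(6)[OF that] E_H F_T that by simp
  have d4: "p v \<notin> T s" if "s \<in> F" "v \<in> V" for s v
    using D(5)[OF that] F_T that by simp
  have d5: "T s \<inter> T s' = {}" if "s \<in> F" "s' \<in> F" "s \<noteq> s'" for s s'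
    using D(7)[OF that] F_T that by simp
  have p_ne: "p a \<in> Q" "p b \<in> Q" "p a \<noteq> p b" if "a \<in> t" "b \<in> t" "a \<noteq> b" for a b
    using that tV inj by (auto simp: Q_def inj_on_def)
  have spoke_sub: "H {x, a} \<subseteq> insert (p a) (T t)" if "a \<in> t" for a
    using sub(4)[of "p a"] that spoke[OF that] by (simp add: Ot Q_def)
  have spoke_Int: "H {x, a} \<inter> H {x, b} \<subseteq> {X}" if "a \<in> t" "b \<in> t" "a \<noteq> b" for a b
    using sub(7)[OF p_ne[OF that]] spoke that by simp
  have new_sub: "T (insert x (t - {a})) \<subseteq> T t" if "a \<in> t" for a
    using sub(3)[of "p a"] that new_face[OF that] Ot by (simp add: T_def Q_def)
  have new_spoke: "H {x, b} \<inter> T (insert x (t - {a})) = {}" if "a \<in> t" "b \<in> t" for a b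
    using sub(5)[of "p b" "p a"] that new_face[of a] spoke[of b] by (simp add: T_def Q_def)
  have new_new: "T (insert x (t - {a})) \<inter> T (insert x (t - {b})) = {}"
    if "a \<in> t" "b \<in> t" "a \<noteq> b" for a b
    using sub(6)[OF p_ne[OF that]] new_face that by (simp add: T_def)
  have X_in: "X \<in> T t" using sub(1) Ot by simp
  have X_new: "X \<notin> T (insert x (t - {a}))" if "a \<in> t" for a
    using new_spoke[OF that that] spoke[OF that] by auto
  have old_spoke: "H e \<inter> H {x, a} \<subseteq> q ` (e \<inter> {x, a})" if "e \<in> E" "a \<in> t" for e a
  proof
    fix z assume z: "z \<in> H e \<inter> H {x, a}"
    then have "z = p a" using spoke_sub[OF that(2)] d3[OF t(1) that(1)] by blast
    then have "a \<in> e" using d1[of e a] that z tV by blast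
    moreover have "z = q a" using \<open>z = p a\<close> qv[of a] that(2) tV by auto
    ultimately show "z \<in> q ` (e \<inter> {x, a})" by blast
  qed
  have "straight_drawing q (insert x V) (E \<union> (\<lambda>a. {x, a}) ` t)
    (F - {t} \<union> (\<lambda>a. insert x (t - {a})) ` t)"
    unfolding straight_drawing_def T_def[symmetric] unfolding H_def[symmetric]
  proof (intro conjI ballI impI)
    have "X \<notin> p ` V" using X_in d4[OF t(1)] by auto
    then show "inj_on q (insert x V)"
      using inj x old[of V] qx inj_on_cong[of V q p] qv by (auto simp: inj_on_insert)
  next
    fix e w assume "e \<in> E \<union> (\<lambda>a. {x, a}) ` t" and w: "w \<in> insert x V" "q w \<in> H e"
    then consider "e \<in> E" | a where "a \<in> t" "e = {x, a}" by blast
    then show "w \<in> e"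
    proof cases
      case 1
      show ?thesis
      proof (cases "w = x")
        case True
        then show ?thesis using w(2) qx X_in d3[OF t(1) 1] by auto
      next
        case False
        then show ?thesis using d1[OF 1, of w] w qv by auto
      qed
    next
      case 2
      show ?thesis
      proof (cases "w = x")
        case False
        then have "w \<in> V" "p w \<in> H {x, a}" using w qv 2 by auto
        then have "p w = p a" using spoke_sub[OF 2(1)] d4[OF t(1)] by blast
        then show ?thesis using inj 2 tV \<open>w \<in> V\<close> by (auto simp: inj_on_def)
      qed (use 2 in simp)
    qed
  next
    fix e e' assume "e \<in> E \<union> (\<lambda>a. {x, a}) ` t" "e' \<in> E \<union> (\<lambda>a. {x, a}) ` t" and ne: "e \<noteq> e'"
    then consider "e \<in> E" "e' \<in> E" | a where "a \<in> t" "e \<in> E" "e' = {x, a}"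
      | a where "a \<in> t" "e = {x, a}" "e' \<in> E" | a b where "a \<in> t" "b \<in> t" "e = {x, a}" "e' = {x, b}"
      by blast
    then show "H e \<inter> H e' \<subseteq> q ` (e \<inter> e')"
    proof cases
      case 1
      then show ?thesis using d2 ne by blast
    next
      case 2
      then show ?thesis using old_spoke by blast
    next
      case 3
      then show ?thesis using old_spoke[of e' a] by (simp add: Int_commute)
    next
      case 4
      then have "a \<noteq> b" using ne by blast
      then show ?thesis using spoke_Int[of a b] 4 qx by auto
    qed
  next
    fix s assume "s \<in> F - {t} \<union> (\<lambda>a. insert x (t - {a})) ` t"
    then consider "s \<in> F" "s \<noteq> t" | a where "a \<in> t" "s = insert x (t - {a})" by blast
    note s = this
    show "\<not> collinear (q ` s)"
      using s
    proof cases
      case 1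
      then show ?thesis using D(4)[of s] old[OF FV[of s]] by simp
    next
      case 2
      then show ?thesis using sub(2)[of "p a"] new_face[of a] by (simp add: Q_def)
    qed
    have "T s \<inter> H e = {}" if e: "e \<in> E \<union> (\<lambda>a. {x, a}) ` t" for e
    proof -
      consider (old) "e \<in> E" | (new) b where "b \<in> t" "e = {x, b}" using e by blast
      note e_cases = this
      show ?thesis using s
      proof cases
        case 1
        show ?thesis using e_cases
        proof cases
          case old
          then show ?thesis using d3[of s e] 1 by simp
        next
          case (new b)
          then have "T s \<inter> T t = {}" "p b \<notin> T s" using d5[of s t] d4[of s b] 1 t(1) tV by auto
          then show ?thesis using spoke_sub[of b] new by blast
        qed
      next
        case (2 a)
        show ?thesis using e_cases
        proof cases
          case old
          then show ?thesis using d3[OF t(1), of e] new_sub[of a] 2 by blast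
        next
          case (new b)
          then show ?thesis using new_spoke[of a b] 2 by blast
        qed
      qed
    qed
    moreover have "T s \<inter> q ` insert x V = {}"
    proof -
      have "q ` insert x V = insert X (p ` V)" using old[of V] qx by simp
      moreover have "X \<notin> T s" using s
      proof cases
        case 1
        then show ?thesis using d5[of s t] t(1) X_in by blast
      qed (use X_new in blast)
      moreover have "p v \<notin> T s" if "v \<in> V" for v using s
      proof cases
        case 1
        then show ?thesis using d4 that by blast
      next
        case 2
        then show ?thesis using d4[OF t(1) that] new_sub by blast
      qed
      ultimately show ?thesis by auto
    qed
    ultimately show "T s \<inter> (q ` insert x V \<union> (\<Union>e\<in>E \<union> (\<lambda>a. {x, a}) ` t. H e)) = {}"
      by blast
  next
    fix s s' assume "s \<in> F - {t} \<union> (\<lambda>a. insert x (t - {a})) ` t"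
      "s' \<in> F - {t} \<union> (\<lambda>a. insert x (t - {a})) ` t" and ne: "s \<noteq> s'"
    then consider "s \<in> F" "s \<noteq> t" "s' \<in> F" "s' \<noteq> t"
      | a where "s \<in> F" "s \<noteq> t" "a \<in> t" "s' = insert x (t - {a})"
      | a where "s' \<in> F" "s' \<noteq> t" "a \<in> t" "s = insert x (t - {a})"
      | a b where "a \<in> t" "s = insert x (t - {a})" "b \<in> t" "s' = insert x (t - {b})"
      by blast
    then show "T s \<inter> T s' = {}"
    proof cases
      case 1
      then show ?thesis using d5 ne by blast
    next
      case 2
      then show ?thesis using d5[of s t] t(1) new_sub[of a] by blast
    next
      case 3
      then show ?thesis using d5[of s' t] t(1) new_sub[of a] by blast
    next
      case 4
      then have "a \<noteq> b" using ne by blast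
      then show ?thesis using 4 new_new[of a b] by blast
    qed
  qed
  then show ?thesis unfolding q_def by blast
qed

lemma stacked_straight_drawing:
  assumes "stacked V E F"
  shows "\<exists>p. straight_drawing p V E F"
  using assms
proof induction
  case (triangle t)
  then show ?case by (rule straight_drawing_triangle)
next
  case (stack V E F t x)
  then obtain p where "straight_drawing p V E F" by blast
  moreover have "card t = 3" "\<And>s. s \<in> F \<Longrightarrow> s \<subseteq> V" "\<And>e. e \<in> E \<Longrightarrow> e \<subseteq> V"
    using stackedD[OF stack.hyps(1)] stack.hyps(2) by simp_all
  ultimately show ?case
    using straight_drawing_stack[of p V E F t x] stack.hyps(2,3) by blast
qed

lemma planar_straight_drawing:
  assumes draw: "straight_drawing p V E F" and "sgraph V E"
  shows "planar V E"
proof -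
  have "\<forall>e\<in>E. \<exists>u v. e = {u, v} \<and> u \<noteq> v \<and> u \<in> V \<and> v \<in> V"
    using assms(2) by (simp add: sgraph_def)
  \<comment> \<open>A path needs a direction, so an order of the two ends is fixed for every
    edge.\<close>
  then obtain a b where ab: "\<And>e. e \<in> E \<Longrightarrow> e = {a e, b e} \<and> a e \<noteq> b e \<and> a e \<in> V \<and> b e \<in> V"
    by metis
  define \<gamma> where "\<gamma> e = linepath (p (a e)) (p (b e))" for e
  have hull: "path_image (\<gamma> e) = convex hull (p ` e)" if "e \<in> E" for e
  proof -
    have "e = {a e, b e}" using ab[OF that] by (rule conjunct1)
    then have "p ` e = p ` {a e, b e}" by (rule arg_cong)
    then show ?thesis by (simp add: \<gamma>_def segment_convex_hull)
  qed
  note inj = straight_drawingD(1)[OF draw]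
  have "arc (\<gamma> e)" "\<exists>u v. e = {u, v} \<and> pathstart (\<gamma> e) = p u \<and> pathfinish (\<gamma> e) = p v" if "e \<in> E" for e
  proof -
    have "p (a e) \<noteq> p (b e)" using ab[OF that] inj by (auto simp: inj_on_def)
    then show "arc (\<gamma> e)" unfolding \<gamma>_def by (rule arc_linepath)
    show "\<exists>u v. e = {u, v} \<and> pathstart (\<gamma> e) = p u \<and> pathfinish (\<gamma> e) = p v"
      using ab[OF that] by (auto simp: \<gamma>_def)
  qed
  then show ?thesis
    unfolding planar_def using straight_drawingD(1-3)[OF draw]
    by (intro exI[of _ p] exI[of _ \<gamma>]) (simp add: hull)
qed

section \<open>Signed neighbourhoods and counting\<close>

definition adj :: "'a set set \<Rightarrow> 'a set set \<Rightarrow> bool \<Rightarrow> 'a \<Rightarrow> 'a \<Rightarrow> bool" where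
  "adj E S neg u v \<longleftrightarrow> {u, v} \<in> E \<and> ({u, v} \<in> S \<longleftrightarrow> neg)"

abbreviation nbrs :: "'a set set \<Rightarrow> 'a set set \<Rightarrow> bool \<Rightarrow> 'a \<Rightarrow> 'a set" where
  "nbrs E S neg u \<equiv> {v. adj E S neg u v}"

lemma adj_commute: "adj E S neg u v \<longleftrightarrow> adj E S neg v u"
  by (simp add: adj_def insert_commute)

lemma adj_sign_unique: "adj E S neg u v \<Longrightarrow> adj E S neg' u v \<Longrightarrow> neg = neg'"
  by (simp add: adj_def)

lemma sgraph_edge:
  assumes "sgraph V E" "{u, v} \<in> E"
  shows "u \<noteq> v" "u \<in> V" "v \<in> V"
proof -
  obtain a b where "{u, v} = {a, b}" "a \<noteq> b" "a \<in> V" "b \<in> V"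
    using assms unfolding sgraph_def by meson
  then show "u \<noteq> v" "u \<in> V" "v \<in> V" by (auto simp: doubleton_eq_iff)
qed

lemma sgraph_adj:
  assumes "sgraph V E" "adj E S neg u v"
  shows "u \<noteq> v" "u \<in> V" "v \<in> V"
  using sgraph_edge[OF assms(1), of u v] assms(2) by (simp_all add: adj_def)

lemma finite_nbrs:
  assumes "sgraph V E"
  shows "finite (nbrs E S neg u)"
proof (rule finite_subset)
  show "nbrs E S neg u \<subseteq> V" using sgraph_adj(3)[OF assms] by blast
  show "finite V" using assms by (simp add: sgraph_def)
qed

lemma sig_hom_adj:
  assumes "sig_hom V E S W F L f" "adj E S neg u v"
  shows "adj F L neg (f u) (f v)"
proof -
  have "f ` {u, v} \<in> F \<and> (f ` {u, v} \<in> L \<longleftrightarrow> {u, v} \<in> S)"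
    using assms unfolding sig_hom_def adj_def by blast
  then show ?thesis using assms(2) by (simp add: adj_def)
qed

text \<open>An edge has one sign and is not a loop, so the three parts are disjoint. The lemma gives
  both 1 + 4 + 4 and 1 + 9 + 9, and it also bounds the degrees in a target with 19 vertices.\<close>

lemma card_neighbourhoods:
  assumes "sgraph V E" "A \<subseteq> nbrs E S False u" "B \<subseteq> nbrs E S True u" "m \<le> card A" "n \<le> card B"
  shows "Suc (m + n) \<le> card (insert u (A \<union> B))"
proof -
  have fin: "finite A" "finite B" using assms(2,3) finite_nbrs[OF assms(1)] by (auto intro: finite_subset)
  have "A \<inter> B = {}" using assms(2,3) adj_sign_unique[of E S False u _ True] by auto
  moreover have "u \<notin> A \<union> B" using assms(2,3) sgraph_adj(1)[OF assms(1)] by blast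
  ultimately have "card (insert u (A \<union> B)) = Suc (card A + card B)"
    using fin by (simp add: card_Un_disjoint)
  then show ?thesis using assms(4,5) by simp
qed

text \<open>The handshake lemma for the edges of one sign. The linear order splits the ordered
  adjacent pairs into two halves that are exchanged by swapping.\<close>

lemma even_sum_card_nbrs:
  fixes W :: "'a::linorder set"
  assumes "sgraph W F"
  shows "even (\<Sum>w\<in>W. card (nbrs F L neg w))"
proof -
  have W: "finite W" using assms by (simp add: sgraph_def)
  define R where "R = (SIGMA w:W. nbrs F L neg w)"
  define A where "A = {(v, w) \<in> R. v < w}"
  define B where "B = {(v, w) \<in> R. w < v}"
  have R: "finite R" unfolding R_def using W finite_nbrs[OF assms] by auto
  have mem: "(v, w) \<in> R \<longleftrightarrow> adj F L neg v w" for v w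
    unfolding R_def using sgraph_adj[OF assms] by auto
  have "v \<noteq> w" if "(v, w) \<in> R" for v w
    using that sgraph_adj(1)[OF assms] unfolding mem by blast
  then have "R = A \<union> B"
    unfolding A_def B_def by (force simp: neq_iff)
  moreover have "A \<inter> B = {}" by (auto simp: A_def B_def)
  moreover have "finite A" "finite B" using R calculation(1) by auto
  moreover have "B = prod.swap ` A"
    unfolding A_def B_def using mem adj_commute[of F L neg] by (auto simp: image_iff)
  then have "card B = card A" by (simp add: card_image)
  ultimately have "card R = 2 * card A" by (simp add: card_Un_disjoint)
  moreover have "card R = (\<Sum>w\<in>W. card (nbrs F L neg w))"
    unfolding R_def using W finite_nbrs[OF assms] by (simp add: card_SigmaI)
  ultimately show ?thesis by simp
qed

text \<open>Vertices at distance one or two on the path differ. If \<open>a = d\<close> and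
  \<open>b = e\<close> held together, one edge would carry both signs, so \<open>d\<close> or
  \<open>e\<close> is a fourth colour. Three edges would not do, because then the ends may
  coincide.\<close>

lemma alternating_path_card:
  assumes "sgraph W F"
    and "adj F L False a b" "adj F L True b c" "adj F L False c d" "adj F L True d e"
  shows "4 \<le> card {a, b, c, d, e}"
proof -
  have ne: "a \<noteq> b" "b \<noteq> c" "c \<noteq> d" "d \<noteq> e" using assms(2-) sgraph_adj(1)[OF assms(1)] by blast+
  have ne2: "a \<noteq> c" "b \<noteq> d" "c \<noteq> e"
    using assms(2-) adj_commute adj_sign_unique by metis+
  have "a \<noteq> d \<or> b \<noteq> e" using assms(2,5) adj_commute adj_sign_unique by metis
  then have "card {a, b, c, d} = 4 \<or> card {a, b, c, e} = 4"
    using ne ne2 by (cases "a = d") auto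
  moreover have "card {a, b, c, d} \<le> card {a, b, c, d, e}" "card {a, b, c, e} \<le> card {a, b, c, d, e}"
    by (intro card_mono; force)+
  ultimately show ?thesis by linarith
qed

section \<open>Gadgets that force colours and degrees\<close>

text \<open>The equation \<open>S' \<inter> E = S\<close>, rather than an inclusion, also keeps the
  positive old edges positive. Signed adjacency thus passes to the larger graph and homomorphisms
  restrict to the smaller one.\<close>

definition extends ::
  "'a set \<Rightarrow> 'a set set \<Rightarrow> 'a set set \<Rightarrow> 'a set \<Rightarrow> 'a set set \<Rightarrow> 'a set set \<Rightarrow> bool" where
  "extends V E S V' E' S' \<longleftrightarrow> V \<subseteq> V' \<and> E \<subseteq> E' \<and> S' \<inter> E = S"

text \<open>Quantifying over all homomorphisms makes a bound survive every extension, because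
  homomorphisms restrict. Gadgets can therefore be analysed once and built upon.\<close>

definition forces_colours :: "'a set \<Rightarrow> 'a set set \<Rightarrow> 'a set set \<Rightarrow> 'a set \<Rightarrow> nat \<Rightarrow> bool" where
  "forces_colours V E S X k \<longleftrightarrow> (\<forall>(W :: nat set) F L f.
     sgraph W F \<longrightarrow> sig_hom V E S W F L f \<longrightarrow> k \<le> card (f ` X))"

text \<open>The degree is that of the colour in the target, for either sign; it is the quantity
  needed for the parity argument.\<close>

definition forces_degrees :: "'a set \<Rightarrow> 'a set set \<Rightarrow> 'a set set \<Rightarrow> 'a \<Rightarrow> nat \<Rightarrow> bool" where
  "forces_degrees V E S u k \<longleftrightarrow> (\<forall>(W :: nat set) F L f neg.
     sgraph W F \<longrightarrow> sig_hom V E S W F L f \<longrightarrow> k \<le> card (nbrs F L neg (f u)))"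

lemma forces_coloursD:
  fixes W :: "nat set"
  shows "forces_colours V E S X k \<Longrightarrow> sgraph W F \<Longrightarrow> sig_hom V E S W F L f \<Longrightarrow> k \<le> card (f ` X)"
  unfolding forces_colours_def by blast

lemma forces_degreesD:
  fixes W :: "nat set"
  shows "forces_degrees V E S u k \<Longrightarrow> sgraph W F \<Longrightarrow> sig_hom V E S W F L f \<Longrightarrow>
    k \<le> card (nbrs F L neg (f u))"
  unfolding forces_degrees_def by blast

definition signed_stacked :: "'a set \<Rightarrow> 'a set set \<Rightarrow> 'a set set \<Rightarrow> bool" where
  "signed_stacked V E S \<longleftrightarrow> (\<exists>F. stacked V E F) \<and> S \<subseteq> E"

lemma extends_trans:
  "extends V E S V' E' S' \<Longrightarrow> extends V' E' S' V'' E'' S'' \<Longrightarrow> extends V E S V'' E'' S''"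
  unfolding extends_def by blast

lemma extends_adj: "extends V E S V' E' S' \<Longrightarrow> adj E S neg u v \<Longrightarrow> adj E' S' neg u v"
  unfolding extends_def adj_def by blast

lemma extends_sig_hom:
  "extends V E S V' E' S' \<Longrightarrow> sig_hom V' E' S' W F L f \<Longrightarrow> sig_hom V E S W F L f"
  unfolding extends_def sig_hom_def by blast

lemma extends_forces_degrees:
  "extends V E S V' E' S' \<Longrightarrow> forces_degrees V E S u k \<Longrightarrow> forces_degrees V' E' S' u k"
  unfolding forces_degrees_def using extends_sig_hom by metis

text \<open>No old edge contains the fresh vertex, so the signs of its edges can be chosen freely
  without changing old ones.\<close>

lemma stack_signed:
  fixes V :: "'a set"
  assumes inf: "infinite (UNIV :: 'a set)" and st: "stacked V E F" "S \<subseteq> E" and t: "t \<in> F"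
  obtains x E' S' F' where "stacked (insert x V) E' F'" "S' \<subseteq> E'" "extends V E S (insert x V) E' S'"
    "\<forall>a\<in>t. adj E' S' (\<sigma> a) a x" "\<forall>a\<in>t. insert x (t - {a}) \<in> F'"
proof -
  have "finite V" using stackedD(1)[OF st(1)] by (simp add: sgraph_def)
  then obtain x where x: "x \<notin> V" using ex_new_if_finite[OF inf] by blast
  have xE: "{a, x} \<notin> E" for a using stackedD(2)[OF st(1), of "{a, x}"] x by blast
  define E' where "E' = E \<union> (\<lambda>a. {x, a}) ` t"
  define S' where "S' = S \<union> (\<lambda>a. {x, a}) ` {a \<in> t. \<sigma> a}"
  have "stacked (insert x V) E' (F - {t} \<union> (\<lambda>a. insert x (t - {a})) ` t)"
    unfolding E'_def using st(1) t x by (rule stacked.stack)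
  moreover have "S' \<subseteq> E'" using st(2) by (auto simp: S'_def E'_def)
  moreover have "extends V E S (insert x V) E' S'"
    using st(2) xE by (auto simp: extends_def S'_def E'_def insert_commute)
  moreover have "adj E' S' (\<sigma> a) a x" if "a \<in> t" for a
  proof -
    have "a \<noteq> x" using stackedD(3)[OF st(1) t] that x by blast
    moreover have "{a, x} \<notin> S" using xE st(2) by blast
    ultimately have "{a, x} \<in> S' \<longleftrightarrow> \<sigma> a"
      unfolding S'_def using that by (auto simp: doubleton_eq_iff)
    moreover have "{a, x} \<in> E'" unfolding E'_def using that by (auto simp: insert_commute)
    ultimately show ?thesis by (simp add: adj_def)
  qed
  moreover have "insert x (t - {a}) \<in> F - {t} \<union> (\<lambda>a. insert x (t - {a})) ` t" if "a \<in> t" for a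
    using that by blast
  ultimately show thesis by (intro that ballI)
qed

text \<open>The resulting face \<open>{u, a, x}\<close> again contains the edge
  \<open>{u, a}\<close>. Iterating with \<open>x\<close> in the place of \<open>p\<close> produces a
  path whose vertices are all joined to both \<open>u\<close> and \<open>a\<close>.\<close>

lemma stack_on_edge:
  fixes V :: "'a set"
  assumes inf: "infinite (UNIV :: 'a set)" and st: "stacked V E F" "S \<subseteq> E" and t: "{u, a, p} \<in> F"
  obtains x V' E' S' F' where "stacked V' E' F'" "S' \<subseteq> E'" "extends V E S V' E' S'" "x \<in> V'"
    "adj E' S' \<sigma> u x" "adj E' S' \<tau> a x" "adj E' S' \<rho> p x" "{u, a, x} \<in> F'"
proof -
  have "card {u, a, p} = 3" using stackedD(4)[OF st(1) t] .
  then have ne: "u \<noteq> a" "u \<noteq> p" "a \<noteq> p"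
    by (auto simp: card_insert_if split: if_splits)
  define s where "s y = (if y = u then \<sigma> else if y = a then \<tau> else \<rho>)" for y
  have s: "s u = \<sigma>" "s a = \<tau>" "s p = \<rho>" using ne by (simp_all add: s_def)
  obtain x E' S' F' where x: "stacked (insert x V) E' F'" "S' \<subseteq> E'" "extends V E S (insert x V) E' S'"
    "\<forall>y\<in>{u, a, p}. adj E' S' (s y) y x"
    "\<forall>y\<in>{u, a, p}. insert x ({u, a, p} - {y}) \<in> F'"
    by (rule stack_signed[OF inf st t, where \<sigma> = s])
  have "insert x ({u, a, p} - {p}) = {u, a, x}" using ne by auto
  then show thesis
    using that[OF x(1-3), of x] x(4,5) s by simp
qed

text \<open>The signs towards \<open>u\<close> and \<open>a\<close> are independent. Two fans with
  opposite signs at \<open>a\<close> can therefore lie in the same signed neighbourhood of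
  \<open>u\<close>.\<close>

lemma fan_extension:
  fixes V :: "'a set"
  assumes inf: "infinite (UNIV :: 'a set)" and st: "signed_stacked V E S" and ua: "{u, a} \<in> E"
  obtains V' E' S' X where "signed_stacked V' E' S'" "extends V E S V' E' S'" "X \<subseteq> V'"
    "X \<subseteq> nbrs E' S' \<sigma> u" "X \<subseteq> nbrs E' S' \<tau> a"
    "forces_colours V' E' S' X 4"
proof -
  obtain F0 where st0: "stacked V E F0" "S \<subseteq> E" using st by (auto simp: signed_stacked_def)
  obtain t where t: "t \<in> F0" "{u, a} \<subseteq> t" using stacked_face_of_edge[OF st0(1) ua] by blast
  have "u \<noteq> a" using sgraph_edge(1)[OF stackedD(1)[OF st0(1)] ua] .
  have "card (t - {u, a}) = 1"
    using stackedD(4)[OF st0(1) t(1)] t(2) \<open>u \<noteq> a\<close> by (simp add: card_Diff_subset)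
  then obtain p where "t - {u, a} = {p}" by (auto simp: card_1_singleton_iff)
  then have "t = {u, a, p}" using t(2) by blast
  then have face0: "{u, a, p} \<in> F0" using t(1) by simp
  \<comment> \<open>The sign towards \<open>p\<close> is an arbitrary choice, as the alternating
    path begins only at \<open>x1\<close>.\<close>
  obtain x1 V1 E1 S1 F1 where 1: "stacked V1 E1 F1" "S1 \<subseteq> E1" "extends V E S V1 E1 S1" "x1 \<in> V1"
    "adj E1 S1 \<sigma> u x1" "adj E1 S1 \<tau> a x1" "adj E1 S1 True p x1" "{u, a, x1} \<in> F1"
    by (rule stack_on_edge[OF inf st0 face0])
  obtain x2 V2 E2 S2 F2 where 2: "stacked V2 E2 F2" "S2 \<subseteq> E2" "extends V1 E1 S1 V2 E2 S2" "x2 \<in> V2"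
    "adj E2 S2 \<sigma> u x2" "adj E2 S2 \<tau> a x2" "adj E2 S2 False x1 x2" "{u, a, x2} \<in> F2"
    by (rule stack_on_edge[OF inf 1(1,2,8)])
  obtain x3 V3 E3 S3 F3 where 3: "stacked V3 E3 F3" "S3 \<subseteq> E3" "extends V2 E2 S2 V3 E3 S3" "x3 \<in> V3"
    "adj E3 S3 \<sigma> u x3" "adj E3 S3 \<tau> a x3" "adj E3 S3 True x2 x3" "{u, a, x3} \<in> F3"
    by (rule stack_on_edge[OF inf 2(1,2,8)])
  obtain x4 V4 E4 S4 F4 where 4: "stacked V4 E4 F4" "S4 \<subseteq> E4" "extends V3 E3 S3 V4 E4 S4" "x4 \<in> V4"
    "adj E4 S4 \<sigma> u x4" "adj E4 S4 \<tau> a x4" "adj E4 S4 False x3 x4" "{u, a, x4} \<in> F4"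
    by (rule stack_on_edge[OF inf 3(1,2,8)])
  obtain x5 V5 E5 S5 F5 where 5: "stacked V5 E5 F5" "S5 \<subseteq> E5" "extends V4 E4 S4 V5 E5 S5" "x5 \<in> V5"
    "adj E5 S5 \<sigma> u x5" "adj E5 S5 \<tau> a x5" "adj E5 S5 True x4 x5" "{u, a, x5} \<in> F5"
    by (rule stack_on_edge[OF inf 4(1,2,8)])
  note e4 = 5(3) and e3 = extends_trans[OF 4(3) 5(3)]
  note e2 = extends_trans[OF 3(3) e3]
  note e1 = extends_trans[OF 2(3) e2]
  note e0 = extends_trans[OF 1(3) e1]
  note a1 = 1(5,6)[THEN extends_adj[OF e1]]
  note a2 = 2(5-7)[THEN extends_adj[OF e2]]
  note a3 = 3(5-7)[THEN extends_adj[OF e3]]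
  note a4 = 4(5-7)[THEN extends_adj[OF e4]]
  note a5 = 5(5-7)
  show thesis
  proof (rule that[OF _ e0])
    show "signed_stacked V5 E5 S5" using 5(1,2) by (auto simp: signed_stacked_def)
    show "{x1, x2, x3, x4, x5} \<subseteq> V5"
      using 1(4) 2(4) 3(4) 4(4) 5(4) e1 e2 e3 e4 by (auto simp: extends_def)
    show "{x1, x2, x3, x4, x5} \<subseteq> nbrs E5 S5 \<sigma> u" "{x1, x2, x3, x4, x5} \<subseteq> nbrs E5 S5 \<tau> a"
      using a1 a2 a3 a4 a5 by simp_all
    show "forces_colours V5 E5 S5 {x1, x2, x3, x4, x5} 4"
      unfolding forces_colours_def
    proof (intro allI impI)
      fix W :: "nat set" and F L f assume hom: "sgraph W F" "sig_hom V5 E5 S5 W F L f"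
      note adj = a2(3) a3(3) a4(3) a5(3)
      show "4 \<le> card (f ` {x1, x2, x3, x4, x5})"
        using alternating_path_card[OF hom(1) adj[THEN sig_hom_adj[OF hom(2)]]] by simp
    qed
  qed
qed

lemma sig_hom_image_nbrs:
  assumes "sig_hom V E S W F L f" "X \<subseteq> nbrs E S neg u"
  shows "f ` X \<subseteq> nbrs F L neg (f u)"
  using assms(2) sig_hom_adj[OF assms(1)] by blast

lemma extends_nbrs: "extends V E S V' E' S' \<Longrightarrow> X \<subseteq> nbrs E S neg u \<Longrightarrow> X \<subseteq> nbrs E' S' neg u"
  using extends_adj[of V E S V' E' S'] by blast

text \<open>A fresh neighbour \<open>a\<close> of \<open>u\<close> serves as the centre of the
  nine-colour gadget. Both fans stand over the edge \<open>{u, a}\<close>, with opposite signs at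
  \<open>a\<close> and the same sign at \<open>u\<close>, so the whole gadget lies in one signed
  neighbourhood of \<open>u\<close>.\<close>

lemma neighbourhood_extension:
  fixes V :: "'a set"
  assumes inf: "infinite (UNIV :: 'a set)" and st: "signed_stacked V E S" and u: "u \<in> V"
  obtains V' E' S' X where "signed_stacked V' E' S'" "extends V E S V' E' S'" "X \<subseteq> V'"
    "X \<subseteq> nbrs E' S' \<sigma> u"
    "forces_colours V' E' S' X 9"
proof -
  obtain F0 where st0: "stacked V E F0" "S \<subseteq> E" using st by (auto simp: signed_stacked_def)
  obtain t where t: "t \<in> F0" "u \<in> t" using stacked_face_of_vertex[OF st0(1) u] by blast
  obtain a V1 E1 S1 F1 where 1: "stacked (insert a V) E1 F1" "S1 \<subseteq> E1" "extends V E S (insert a V) E1 S1"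
    "\<forall>y\<in>t. adj E1 S1 \<sigma> y a" "\<forall>y\<in>t. insert a (t - {y}) \<in> F1"
    by (rule stack_signed[OF inf st0 t(1), where \<sigma> = "\<lambda>_. \<sigma>"])
  have st1: "signed_stacked (insert a V) E1 S1" using 1(1,2) by (auto simp: signed_stacked_def)
  have a: "adj E1 S1 \<sigma> u a" using 1(4) t(2) by blast
  then have "{u, a} \<in> E1" by (simp add: adj_def)
  then obtain V2 E2 S2 X where 2: "signed_stacked V2 E2 S2" "extends (insert a V) E1 S1 V2 E2 S2" "X \<subseteq> V2"
    "X \<subseteq> nbrs E2 S2 \<sigma> u" "X \<subseteq> nbrs E2 S2 False a"
    "forces_colours V2 E2 S2 X 4"
    by (rule fan_extension[OF inf st1, where \<sigma> = \<sigma> and \<tau> = False])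
  have "{u, a} \<in> E2" using \<open>{u, a} \<in> E1\<close> 2(2) by (auto simp: extends_def)
  then obtain V3 E3 S3 Y where 3: "signed_stacked V3 E3 S3" "extends V2 E2 S2 V3 E3 S3" "Y \<subseteq> V3"
    "Y \<subseteq> nbrs E3 S3 \<sigma> u" "Y \<subseteq> nbrs E3 S3 True a"
    "forces_colours V3 E3 S3 Y 4"
    by (rule fan_extension[OF inf 2(1), where \<sigma> = \<sigma> and \<tau> = True])
  note e1 = extends_trans[OF 2(2) 3(2)]
  show thesis
  proof (rule that[OF 3(1) extends_trans[OF 1(3) e1]])
    show "insert a (X \<union> Y) \<subseteq> V3" using 2(3) 3(2,3) e1 by (auto simp: extends_def)
    show "insert a (X \<union> Y) \<subseteq> nbrs E3 S3 \<sigma> u"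
      using extends_adj[OF e1 a] extends_nbrs[OF 3(2) 2(4)] 3(4) by blast
    show "forces_colours V3 E3 S3 (insert a (X \<union> Y)) 9"
      unfolding forces_colours_def
    proof (intro allI impI)
      fix W :: "nat set" and F L f assume hom: "sgraph W F" "sig_hom V3 E3 S3 W F L f"
      have "Suc (4 + 4) \<le> card (insert (f a) (f ` X \<union> f ` Y))"
        by (rule card_neighbourhoods[OF hom(1)
              sig_hom_image_nbrs[OF hom(2) extends_nbrs[OF 3(2) 2(5)]]
              sig_hom_image_nbrs[OF hom(2) 3(5)]
              forces_coloursD[OF 2(6) hom(1) extends_sig_hom[OF 3(2) hom(2)]]
              forces_coloursD[OF 3(6) hom]])
      then show "9 \<le> card (f ` insert a (X \<union> Y))" by (simp add: image_Un)
    qed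
  qed
qed

text \<open>The colour bound supplies the core with 19 colours; the degree bound is what is then
  imposed on every vertex of that core.\<close>

lemma saturated_vertex_extension:
  fixes V :: "'a set"
  assumes inf: "infinite (UNIV :: 'a set)" and st: "signed_stacked V E S" and u: "u \<in> V"
  obtains V' E' S' where "signed_stacked V' E' S'" "extends V E S V' E' S'"
    "forces_degrees V' E' S' u 9"
    "forces_colours V' E' S' V' 19"
proof -
  obtain V1 E1 S1 X where 1: "signed_stacked V1 E1 S1" "extends V E S V1 E1 S1" "X \<subseteq> V1"
    "X \<subseteq> nbrs E1 S1 False u"
    "forces_colours V1 E1 S1 X 9"
    by (rule neighbourhood_extension[OF inf st u, where \<sigma> = False])
  have "u \<in> V1" using u 1(2) by (auto simp: extends_def)
  then obtain V2 E2 S2 Y where 2: "signed_stacked V2 E2 S2" "extends V1 E1 S1 V2 E2 S2" "Y \<subseteq> V2"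
    "Y \<subseteq> nbrs E2 S2 True u"
    "forces_colours V2 E2 S2 Y 9"
    by (rule neighbourhood_extension[OF inf 1(1), where \<sigma> = True])
  show thesis
  proof (rule that[OF 2(1) extends_trans[OF 1(2) 2(2)]])
    have X: "f ` X \<subseteq> nbrs F L False (f u)" "9 \<le> card (f ` X)"
      and Y: "f ` Y \<subseteq> nbrs F L True (f u)" "9 \<le> card (f ` Y)"
      if "sgraph W F" "sig_hom V2 E2 S2 W F L f" for W :: "nat set" and F L f
      using sig_hom_image_nbrs[OF that(2) extends_nbrs[OF 2(2) 1(4)]]
        forces_coloursD[OF 1(5) that(1) extends_sig_hom[OF 2(2) that(2)]]
        sig_hom_image_nbrs[OF that(2) 2(4)] forces_coloursD[OF 2(5) that] by blast+
    show "forces_degrees V2 E2 S2 u 9"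
      unfolding forces_degrees_def
    proof (intro allI impI)
      fix W :: "nat set" and F L f neg assume hom: "sgraph W F" "sig_hom V2 E2 S2 W F L f"
      show "9 \<le> card (nbrs F L neg (f u))"
        using order_trans[OF X(2)[OF hom] card_mono[OF finite_nbrs[OF hom(1)] X(1)[OF hom]]]
          order_trans[OF Y(2)[OF hom] card_mono[OF finite_nbrs[OF hom(1)] Y(1)[OF hom]]]
        by (cases neg) simp_all
    qed
    show "forces_colours V2 E2 S2 V2 19"
      unfolding forces_colours_def
    proof (intro allI impI)
      fix W :: "nat set" and F L f assume hom: "sgraph W F" "sig_hom V2 E2 S2 W F L f"
      have "Suc (9 + 9) \<le> card (insert (f u) (f ` X \<union> f ` Y))"
        by (rule card_neighbourhoods[OF hom(1) X(1)[OF hom] Y(1)[OF hom] X(2)[OF hom] Y(2)[OF hom]])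
      also have "\<dots> \<le> card (f ` V2)"
      proof (rule card_mono)
        have "finite W" using hom(1) by (simp add: sgraph_def)
        then show "finite (f ` V2)" using hom(2) by (auto simp: sig_hom_def intro: finite_subset)
        show "insert (f u) (f ` X \<union> f ` Y) \<subseteq> f ` V2"
          using 1(3) 2(2,3) \<open>u \<in> V1\<close> by (auto simp: extends_def)
      qed
      finally show "19 \<le> card (f ` V2)" by simp
    qed
  qed
qed

text \<open>The vertices of \<open>A\<close> are treated one at a time; degree bounds already
  obtained persist under later extensions.\<close>

lemma saturated_extension:
  fixes V :: "'a set"
  assumes inf: "infinite (UNIV :: 'a set)" and A: "finite A" "A \<subseteq> V" and st: "signed_stacked V E S"
  shows "\<exists>V' E' S'. signed_stacked V' E' S' \<and> extends V E S V' E' S' \<and>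
    (\<forall>u\<in>A. forces_degrees V' E' S' u 9)"
  using A
proof (induction A)
  case empty
  have "extends V E S V E S" using st by (auto simp: extends_def signed_stacked_def)
  then show ?case using st by blast
next
  case (insert u A)
  then obtain V1 E1 S1 where 1: "signed_stacked V1 E1 S1" "extends V E S V1 E1 S1"
    "\<forall>v\<in>A. forces_degrees V1 E1 S1 v 9"
    by (metis insert_subset)
  have "u \<in> V1" using insert.prems 1(2) by (auto simp: extends_def)
  then obtain V2 E2 S2 where 2: "signed_stacked V2 E2 S2" "extends V1 E1 S1 V2 E2 S2"
    "forces_degrees V2 E2 S2 u 9" "forces_colours V2 E2 S2 V2 19"
    by (rule saturated_vertex_extension[OF inf 1(1)])
  have "\<forall>v\<in>insert u A. forces_degrees V2 E2 S2 v 9"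
    using 1(3) 2(3) extends_forces_degrees[OF 2(2)] by blast
  then show ?case using 2(1) extends_trans[OF 1(2) 2(2)] by blast
qed

section \<open>The parity argument and the exact value\<close>

lemma stacked_lower_bound:
  obtains V :: "nat set" and E F S where "stacked V E F" "S \<subseteq> E"
    "\<forall>(W :: nat set) F L f. sgraph W F \<longrightarrow> sig_hom V E S W F L f \<longrightarrow> 20 \<le> card W"
proof -
  define E0 :: "nat set set" where "E0 = {{u, v} |u v. u \<in> {0, 1, 2} \<and> v \<in> {0, 1, 2} \<and> u \<noteq> v}"
  have "stacked {0, 1, 2} E0 {{0, 1, 2}}"
    unfolding E0_def by (rule stacked.triangle) simp
  then have st0: "signed_stacked {0, 1, 2} E0 {}" by (auto simp: signed_stacked_def)
  have "0 \<in> {0, 1, 2 :: nat}" by simp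
  then obtain V1 E1 S1 where 1: "signed_stacked V1 E1 S1" "extends {0, 1, 2} E0 {} V1 E1 S1"
    "forces_degrees V1 E1 S1 0 9"
    "forces_colours V1 E1 S1 V1 19"
    by (rule saturated_vertex_extension[OF infinite_UNIV_nat st0])
  have "finite V1" using 1(1) stackedD(1) unfolding signed_stacked_def sgraph_def by blast
  then obtain V E S where 2: "signed_stacked V E S" "extends V1 E1 S1 V E S"
    "\<forall>u\<in>V1. forces_degrees V E S u 9"
    using saturated_extension[OF infinite_UNIV_nat _ subset_refl 1(1)] by blast
  have "20 \<le> card W" if hom: "sgraph W F" "sig_hom V E S W F L f" for W :: "nat set" and F L f
  proof (rule ccontr)
    assume "\<not> 20 \<le> card W"
    then have W19: "card W \<le> 19" by simp
    have W: "finite W" using hom(1) by (simp add: sgraph_def)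
    note hom1 = extends_sig_hom[OF 2(2) hom(2)]
    have sub: "f ` V1 \<subseteq> W" using hom1 by (simp add: sig_hom_def)
    have c19: "19 \<le> card (f ` V1)" by (rule forces_coloursD[OF 1(4) hom(1) hom1])
    have "card (f ` V1) \<le> card W" using sub W by (rule card_mono[rotated])
    then have card: "card W = 19" "card (f ` V1) = card W" using c19 W19 by simp_all
    \<comment> \<open>The core \<open>V1\<close> already uses all 19 colours, so the degree bounds
      at its vertices hold at every vertex of the target.\<close>
    have onto: "f ` V1 = W" by (rule card_subset_eq[OF W sub card(2)])
    \<comment> \<open>Both signed degrees are at least 9 and, together with the vertex itself, they
      fit into 19, so equality holds.\<close>
    have "card (nbrs F L False w) = 9" if "w \<in> W" for w
    proof -
      have 9: "9 \<le> card (nbrs F L neg w)" for neg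
        using forces_degreesD[OF _ hom] 2(3) that onto by blast
      have "Suc (card (nbrs F L False w) + card (nbrs F L True w)) \<le>
          card (insert w (nbrs F L False w \<union> nbrs F L True w))"
        by (rule card_neighbourhoods[OF hom(1) subset_refl subset_refl order_refl order_refl])
      also have "\<dots> \<le> card W"
        using that sgraph_adj(3)[OF hom(1)] by (intro card_mono[OF W]) auto
      finally show ?thesis using 9[of False] 9[of True] card(1) by simp
    qed
    then have "(\<Sum>w\<in>W. card (nbrs F L False w)) = 19 * 9" by (simp add: card(1))
    then show False using even_sum_card_nbrs[OF hom(1), of L False] by simp
  qed
  then show thesis using that 2(1) unfolding signed_stacked_def by blast
qed

lemma chi2_sig_le:
  fixes W :: "nat set"
  assumes "sgraph W F" "L \<subseteq> F" "sig_hom V E S W F L f"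
  shows "chi2_sig V E S \<le> card W"
  unfolding chi2_sig_def by (rule Least_le) (use assms in blast)

text \<open>\<open>LEAST\<close> is attained once some target exists; the Tromp graph will be that
  witness.\<close>

lemma chi2_sig_attained:
  fixes W :: "nat set"
  assumes "sgraph W F" "L \<subseteq> F" "sig_hom V E S W F L f"
  obtains W' :: "nat set" and F' L' f' where "sgraph W' F'" "L' \<subseteq> F'" "card W' = chi2_sig V E S"
    "sig_hom V E S W' F' L' f'"
proof -
  have "\<exists>(W :: nat set) F L f. sgraph W F \<and> L \<subseteq> F \<and> card W = chi2_sig V E S \<and> sig_hom V E S W F L f"
    unfolding chi2_sig_def by (rule LeastI[of _ "card W"]) (use assms in blast)
  then show thesis using that by blast
qed

theorem mainTheorem13:
  shows "\<exists>(V :: nat set) E. sgraph V E \<and> planar V E \<and> chi2 V E = 20"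
proof -
  obtain V :: "nat set" and E F S where st: "stacked V E F" and S: "S \<subseteq> E"
    and lower: "\<forall>(W :: nat set) F L f. sgraph W F \<longrightarrow> sig_hom V E S W F L f \<longrightarrow> 20 \<le> card W"
    by (rule stacked_lower_bound)
  have sg: "sgraph V E" by (rule stackedD(1)[OF st])
  have "planar V E" using stacked_straight_drawing[OF st] planar_straight_drawing sg by blast
  have upper: "chi2_sig V E S' \<le> 20" for S'
    using stacked_hom_tromp[OF st, of S'] chi2_sig_le[OF sgraph_tromp tromp_neg_edges_subset] by force
  obtain f where "sig_hom V E S {..<20} tromp_edges tromp_neg_edges f"
    using stacked_hom_tromp[OF st] by blast
  then have "20 \<le> chi2_sig V E S"
    using chi2_sig_attained[OF sgraph_tromp tromp_neg_edges_subset] lower by metis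
  then have attained: "chi2_sig V E S = 20" using upper[of S] by simp
  \<comment> \<open>Finiteness of \<open>E\<close> leaves finitely many signatures, so that
    \<open>Max\<close> is the true maximum.\<close>
  have "E \<subseteq> Pow V" using stackedD(2)[OF st] by blast
  then have "finite E" using sg by (auto simp: sgraph_def intro: finite_subset)
  then have "finite {chi2_sig V E S' |S'. S' \<subseteq> E}" by (simp add: setcompr_eq_image Collect_mem_eq)
  then have "chi2 V E = 20"
    unfolding chi2_def using upper attained S by (intro Max_eqI) (auto intro: sym)
  then show ?thesis using sg \<open>planar V E\<close> by blast
qed

end
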